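(* If a permutation $w$ is $3$-vexillary, then its essential set does not contain any three cells $(i_{1},j_{1}),(i_{2},j_{2}),(i_{3},j_{3})$ with $i_{1}<i_{2}<i_{3}$ and $j_{1}<j_{2}<j_{3}$.
   Context: For $w\in S_n$ the diagram of $w$ is $D(w)=\{(i,w(j)): 1\le i<j\le n,\ w(i)>w(j)\}$, drawn with matrix coordinates (row $i$, column $j$). The essential set $Ess(w)$ is the set of southeast corners of the connected components of $D(w)$, i.e. the cells $(i,j)\in D(w)$ with $(i+1,j)\notin D(w)$ and $(i,j+1)\notin D(w)$. Let $s_i=(i\ i{+}1)$. A reduced word of $w$ is a minimal-length sequence $(a_1,\dots,a_{\ell})$ with $s_{a_1}\cdots s_{a_{\ell}}=w$ (right multiplication by $s_i$ swaps the entries in positions $i$ and $i+1$). $\mathcal{EG}(w)$ is the set of semistandard Young tableaux (English notation) whose column word, obtained by reading each column from bottom to top, starting with the leftmost column and moving right, is a reduced word of $w$. Put $EG(w)=|\mathcal{EG}(w)|$. A permutation $w$ is $3$-vexillary if $EG(w)\le 3$. *)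

theory Defs
  imports Main "HOL-Combinatorics.Permutations"
begin

text \<open>
  A permutation \<open>w \<in> S\<^sub>n\<close> is a function with \<open>w permutes {1..n}\<close>. The group operation is
  composition of functions, so \<open>w \<circ> s\<^sub>i\<close> swaps the entries of \<open>w\<close> in positions \<open>i\<close> and \<open>i + 1\<close>.
\<close>

definition diagram :: "nat \<Rightarrow> (nat \<Rightarrow> nat) \<Rightarrow> (nat \<times> nat) set" where
  "diagram n w = {(i, w j) | i j. 1 \<le> i \<and> i < j \<and> j \<le> n \<and> w i > w j}"

definition essential_set :: "nat \<Rightarrow> (nat \<Rightarrow> nat) \<Rightarrow> (nat \<times> nat) set" where
  "essential_set n w =
     {(i, j). (i, j) \<in> diagram n w \<and> (i + 1, j) \<notin> diagram n w \<and> (i, j + 1) \<notin> diagram n w}"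

definition simple_transposition :: "nat \<Rightarrow> nat \<Rightarrow> nat" where
  "simple_transposition i = Transposition.transpose i (i + 1)"

definition word_perm :: "nat list \<Rightarrow> nat \<Rightarrow> nat" where
  "word_perm a = foldr (\<lambda>i f. simple_transposition i \<circ> f) a id"

definition words_of :: "nat \<Rightarrow> (nat \<Rightarrow> nat) \<Rightarrow> nat list set" where
  "words_of n w = {a. set a \<subseteq> {1..<n} \<and> word_perm a = w}"

definition reduced_words :: "nat \<Rightarrow> (nat \<Rightarrow> nat) \<Rightarrow> nat list set" where
  "reduced_words n w = {a \<in> words_of n w. \<forall>b \<in> words_of n w. length a \<le> length b}"

text \<open>
  A tableau in English notation is the list of its rows, from top to bottom; \<open>List.transpose\<close>
  gives the list of its columns, from left to right. Requiring the rows to be nonempty makes the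
  representation unique; the empty tableau is \<open>[]\<close>.
\<close>

definition semistandard :: "nat list list \<Rightarrow> bool" where
  "semistandard T \<longleftrightarrow>
     [] \<notin> set T \<and> sorted_wrt (\<ge>) (map length T) \<and>
     (\<forall>r \<in> set T. sorted r \<and> (\<forall>x \<in> set r. x \<ge> 1)) \<and>
     (\<forall>c \<in> set (List.transpose T). sorted_wrt (<) c)"

definition column_word :: "nat list list \<Rightarrow> nat list" where
  "column_word T = concat (map rev (List.transpose T))"

definition EG_tableaux :: "nat \<Rightarrow> (nat \<Rightarrow> nat) \<Rightarrow> nat list list set" where
  "EG_tableaux n w = {T. semistandard T \<and> column_word T \<in> reduced_words n w}"

definition EG :: "nat \<Rightarrow> (nat \<Rightarrow> nat) \<Rightarrow> nat" where
  "EG n w = card (EG_tableaux n w)"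

definition k_vexillary :: "nat \<Rightarrow> nat \<Rightarrow> (nat \<Rightarrow> nat) \<Rightarrow> bool" where
  "k_vexillary k n w \<longleftrightarrow> EG n w \<le> k"

text \<open>The set of tableaux is finite, so \<open>EG n w\<close> is its true cardinality.\<close>

lemma mset_concat_transpose: "mset (concat (List.transpose T)) = mset (concat T)"
proof (induction T rule: List.transpose.induct)
  case (3 x xs xss)
  have *: "mset (concat xss) =
      mset (concat (map (case_list [] (\<lambda>h t. [h])) xss)) +
      mset (concat (concat (map (case_list [] (\<lambda>h t. [t])) xss)))"
    by (induction xss) (auto split: list.split)
  show ?case using 3 * by simp
qed simp_all

lemma mset_column_word: "mset (column_word T) = mset (concat T)"
proof -
  have "mset (concat (map rev U)) = mset (concat U)" for U :: "nat list list"
    by (induction U) auto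
  then show ?thesis by (simp add: column_word_def mset_concat_transpose)
qed

lemma finite_EG_tableaux: "finite (EG_tableaux n w)"
proof (cases "reduced_words n w = {}")
  case True
  then show ?thesis by (simp add: EG_tableaux_def)
next
  case False
  then obtain a where a: "a \<in> reduced_words n w" by blast
  define L where "L = length a"
  let ?R = "{r. set r \<subseteq> {1..<n} \<and> length r \<le> L}"
  have "EG_tableaux n w \<subseteq> {T. set T \<subseteq> ?R \<and> length T \<le> L}"
  proof
    fix T assume T: "T \<in> EG_tableaux n w"
    have len: "length (concat T) \<le> L"
      using T a mset_eq_length[OF mset_column_word[of T]]
      by (auto simp: EG_tableaux_def reduced_words_def L_def)
    have set: "set (concat T) \<subseteq> {1..<n}"
      using T mset_eq_setD[OF mset_column_word[of T]]
      by (auto simp: EG_tableaux_def reduced_words_def words_of_def)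
    have ne: "[] \<notin> set T" using T by (simp add: EG_tableaux_def semistandard_def)
    have "length T \<le> length (concat T)" using ne
    proof (induction T)
      case (Cons r T)
      then have "length r \<ge> 1" by (cases r) auto
      with Cons show ?case by auto
    qed simp
    moreover have "length r \<le> length (concat T)" if "r \<in> set T" for r
      using that by (induction T) auto
    ultimately show "T \<in> {T. set T \<subseteq> ?R \<and> length T \<le> L}"
      using len set by fastforce
  qed
  moreover have "finite {T. set T \<subseteq> ?R \<and> length T \<le> L}"
    by (intro finite_lists_length_le) simp_all
  ultimately show ?thesis by (rule finite_subset)
qed

end

theory Submission
  imports Defs
begin

text \<open>
  Let \<open>w(p) = n\<close> and let \<open>v\<close> be \<open>w\<close> with the value \<open>n\<close> deleted. Edelman-Greene insertion of the
  decreasing word \<open>n - 1, \<dots>, p\<close> is an explicit injection from the tableaux of \<open>v\<close> to those of \<open>w\<close>: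
  it lengthens each of the first \<open>n - p\<close> rows by one. Passing to inverses and transposing, deletion
  of the last position likewise gives an injection that lengthens columns.

  These injections give lower bounds for \<open>EG(w)\<close> in two ways. First, delete the values down to some
  \<open>t\<close> and then only last positions; the resulting tableaux have shapes that decrease in dominance
  order as \<open>t\<close> grows, with a strict step at every \<open>strict_value\<close>. Every pattern 2143 produces a
  strict value, so it gives two tableaux, and three strict values give four.
  Secondly, if a suitable pattern forces a large rectangle into the shape of every tableau of \<open>v\<close>,
  then the images of the two injections are disjoint, and if both deletions leave a pattern 2143,
  there are again at least four tableaux.

  Three essential cells in a chain provide a descent north-west of the second cell, two points
  around the second cell, and an inversion south-east of it. Depending on the position of these
  points, either there are three strict values for \<open>w\<close> or for its inverse, or the second
  argument applies to the part of \<open>w\<close> north-west of a suitable inversion.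
\<close>

section \<open>Words and tableaux\<close>

text \<open>Counting shapes cannot finish the proof. The permutation 214365 has the essential cells
  (1,1), (3,3), (5,5); its tableaux are the four standard fillings with the letters 1, 3, 5, two of
  which share the shape (2,1). It is its own inverse and has only the strict values 4 and 6, which
  yield three tableaux. Tableaux of equal shape must be told apart by the place of their largest
  letter, and this is what comparing the two insertions achieves: it is the reason for the second
  argument.

  Insertion of a whole descending word into a strict row has a closed form. If the row is A B with A
  below \<open>q\<close> and B at least \<open>q\<close>, the new row is A q (B+1), where B+1 is B
  with all letters raised by one. Shape, reducedness and injectivity can be read off from it without
  following single bumps.\<close>

text \<open>The letter 0 stands for an empty cell.\<close>

definition adj_swap :: "nat \<Rightarrow> nat \<Rightarrow> nat" where
  "adj_swap x = (if x = 0 then id else simple_transposition x)"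

definition word_prod :: "nat list \<Rightarrow> nat \<Rightarrow> nat" where
  "word_prod xs = foldr (\<lambda>x f. adj_swap x \<circ> f) xs id"

lemma word_prod_Nil [simp]: "word_prod [] = id"
  by (simp add: word_prod_def)

lemma word_prod_Cons [simp]: "word_prod (x # xs) = adj_swap x \<circ> word_prod xs"
  by (simp add: word_prod_def)

lemma word_prod_append [simp]: "word_prod (xs @ ys) = word_prod xs \<circ> word_prod ys"
  by (induction xs) (auto simp: comp_assoc)

lemma adj_swap_0 [simp]: "adj_swap 0 = id"
  by (simp add: adj_swap_def)

lemma adj_swap_apply: "adj_swap x y = (if x = 0 then y else if y = x then Suc x else if y = Suc x then x else y)"
  by (simp add: adj_swap_def simple_transposition_def Transposition.transpose_def)

lemma adj_swap_adj_swap [simp]: "adj_swap x \<circ> adj_swap x = id"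
  by (auto simp: adj_swap_apply fun_eq_iff)

lemma adj_swap_commute: "x + 2 \<le> y \<Longrightarrow> adj_swap x \<circ> adj_swap y = adj_swap y \<circ> adj_swap x"
  by (auto simp: adj_swap_apply fun_eq_iff)

lemma word_perm_filter: "word_perm (filter (\<lambda>x. x \<noteq> 0) xs) = word_prod xs"
  by (induction xs) (auto simp: word_perm_def adj_swap_def)

lemma word_prod_commute:
  assumes "\<And>x. x \<in> set xs \<Longrightarrow> adj_swap y \<circ> adj_swap x = adj_swap x \<circ> adj_swap y"
  shows "adj_swap y \<circ> word_prod xs = word_prod xs \<circ> adj_swap y"
  using assms
proof (induction xs)
  case (Cons x xs)
  have "adj_swap y \<circ> word_prod (x # xs) = (adj_swap y \<circ> adj_swap x) \<circ> word_prod xs" by (simp add: comp_assoc)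
  also have "\<dots> = (adj_swap x \<circ> adj_swap y) \<circ> word_prod xs"
    by (simp only: Cons.prems[OF list.set_intros(1)])
  also have "\<dots> = adj_swap x \<circ> (adj_swap y \<circ> word_prod xs)" by (simp add: comp_assoc)
  also have "adj_swap y \<circ> word_prod xs = word_prod xs \<circ> adj_swap y" using Cons.prems by (intro Cons.IH) simp
  also have "adj_swap x \<circ> \<dots> = word_prod (x # xs) \<circ> adj_swap y" by (simp add: comp_assoc)
  finally show ?case .
qed simp

lemma word_prod_rev: "word_prod (rev xs) \<circ> word_prod xs = id" "word_prod xs \<circ> word_prod (rev xs) = id"
proof -
  show *: "word_prod (rev xs) \<circ> word_prod xs = id" for xs
  proof (induction xs)
    case (Cons x xs)
    have "word_prod (rev (x # xs)) \<circ> word_prod (x # xs) = word_prod (rev xs) \<circ> (adj_swap x \<circ> adj_swap x) \<circ> word_prod xs"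
      by (simp add: comp_assoc del: adj_swap_adj_swap)
    then show ?case using Cons by (simp only: adj_swap_adj_swap comp_id)
  qed simp
  show "word_prod xs \<circ> word_prod (rev xs) = id" using *[of "rev xs"] by simp
qed

lemma word_prod_rev_inv: "word_prod (rev xs) = inv (word_prod xs)"
  using inv_unique_comp[OF word_prod_rev(2) word_prod_rev(1)] ..

text \<open>
  A tableau is a matrix indexed from 0, whose entry is 0 outside the shape. Rows are required to be
  strictly increasing as well.
\<close>

definition strict_tab :: "(nat \<Rightarrow> nat \<Rightarrow> nat) \<Rightarrow> bool" where
  "strict_tab t \<longleftrightarrow> (\<forall>i j. t i (Suc j) \<noteq> 0 \<longrightarrow> t i j \<noteq> 0 \<and> t i j < t i (Suc j)) \<and>
                (\<forall>i j. t (Suc i) j \<noteq> 0 \<longrightarrow> t i j \<noteq> 0 \<and> t i j < t (Suc i) j)"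

definition flip_tab :: "(nat \<Rightarrow> nat \<Rightarrow> nat) \<Rightarrow> nat \<Rightarrow> nat \<Rightarrow> nat" where
  "flip_tab t i j = t j i"

lemma flip_tab_flip_tab [simp]: "flip_tab (flip_tab t) = t"
  by (simp add: flip_tab_def fun_eq_iff)

lemma strict_tab_flip_tab [simp]: "strict_tab (flip_tab t) = strict_tab t"
  unfolding strict_tab_def flip_tab_def by blast

lemma strict_tab_rowD:
  assumes "strict_tab t" "t i (Suc j) \<noteq> 0" shows "t i j \<noteq> 0" "t i j < t i (Suc j)"
  using assms unfolding strict_tab_def by blast+

lemma strict_tab_colD:
  assumes "strict_tab t" "t (Suc i) j \<noteq> 0" shows "t i j \<noteq> 0" "t i j < t (Suc i) j"
  using assms unfolding strict_tab_def by blast+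

lemma strict_tab_row: "strict_tab t \<Longrightarrow> t i (j + k) \<noteq> 0 \<Longrightarrow> t i j \<noteq> 0 \<and> t i j + k \<le> t i (j + k)"
proof (induction k)
  case (Suc k)
  then have 1: "t i (j + k) \<noteq> 0" "t i (j + k) < t i (Suc (j + k))"
    using strict_tab_rowD[of t i "j + k"] by simp_all
  then have "t i j \<noteq> 0 \<and> t i j + k \<le> t i (j + k)" using Suc.IH Suc.prems(1) by blast
  then show ?case using 1 by simp
qed simp

lemma strict_tab_col: "strict_tab t \<Longrightarrow> t (i + k) j \<noteq> 0 \<Longrightarrow> t i j \<noteq> 0 \<and> t i j + k \<le> t (i + k) j"
  using strict_tab_row[of "flip_tab t" j i k] by (simp add: flip_tab_def)

lemma strict_tab_le:
  assumes "strict_tab t" "t i' j' \<noteq> 0" "i \<le> i'" "j \<le> j'"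
  shows "t i j \<noteq> 0" "t i j + (i' - i) + (j' - j) \<le> t i' j'"
proof -
  obtain k l where kl: "i' = i + k" "j' = j + l"
    using le_Suc_ex[OF assms(3)] le_Suc_ex[OF assms(4)] by blast
  have 1: "t (i + k) j \<noteq> 0 \<and> t (i + k) j + l \<le> t (i + k) (j + l)"
    using assms kl by (intro strict_tab_row) auto
  then have 2: "t i j \<noteq> 0 \<and> t i j + k \<le> t (i + k) j"
    using assms kl by (intro strict_tab_col) auto
  show "t i j \<noteq> 0" "t i j + (i' - i) + (j' - j) \<le> t i' j'" using 1 2 kl by auto
qed

definition row_word :: "(nat \<Rightarrow> nat \<Rightarrow> nat) \<Rightarrow> nat \<Rightarrow> nat \<Rightarrow> nat list" where
  "row_word t a b = concat (map (\<lambda>i. map (t i) [0..<b]) (rev [0..<a]))"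

definition col_word :: "(nat \<Rightarrow> nat \<Rightarrow> nat) \<Rightarrow> nat \<Rightarrow> nat \<Rightarrow> nat list" where
  "col_word t a b = concat (map (\<lambda>j. map (\<lambda>i. t i j) (rev [0..<a])) [0..<b])"

lemma row_word_0 [simp]: "row_word t 0 b = []" and row_word_0' [simp]: "row_word t a 0 = []"
  and row_word_Suc: "row_word t (Suc a) b = map (t a) [0..<b] @ row_word t a b"
  by (auto simp: row_word_def)

lemma col_word_0 [simp]: "col_word t a 0 = []"
  and col_word_Suc: "col_word t a (Suc b) = col_word t a b @ map (\<lambda>i. t i b) (rev [0..<a])"
  by (auto simp: col_word_def)

lemma in_set_row_word: "x \<in> set (row_word t a b) \<longleftrightarrow> (\<exists>i<a. \<exists>j<b. x = t i j)"
  by (simp add: row_word_def) fastforce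

text \<open>
  Two cells that the row and column readings visit in different order lie strictly north-west and
  south-east of each other, so that their entries differ by at least 2.
\<close>

lemma word_prod_row_word_Suc:
  assumes "strict_tab t"
  shows "word_prod (row_word t a (Suc b)) = word_prod (row_word t a b) \<circ> word_prod (map (\<lambda>i. t i b) (rev [0..<a]))"
proof (induction a)
  case (Suc a)
  have comm: "adj_swap (t a b) \<circ> word_prod (row_word t a b) = word_prod (row_word t a b) \<circ> adj_swap (t a b)"
  proof (cases "t a b = 0")
    case False
    show ?thesis
    proof (rule word_prod_commute)
      fix x assume "x \<in> set (row_word t a b)"
      then obtain i j where ij: "i < a" "j < b" "x = t i j" by (auto simp: in_set_row_word)
      have "x + (a - i) + (b - j) \<le> t a b"
        using strict_tab_le(2)[OF assms False, of i j] ij by auto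
      then have "x + 2 \<le> t a b" using ij by linarith
      then show "adj_swap (t a b) \<circ> adj_swap x = adj_swap x \<circ> adj_swap (t a b)" by (rule adj_swap_commute[symmetric])
    qed
  qed simp
  have comm': "adj_swap (t a b) (word_prod (row_word t a b) x) = word_prod (row_word t a b) (adj_swap (t a b) x)" for x
    using fun_cong[OF comm, of x] by simp
  show ?case by (rule ext) (simp add: row_word_Suc Suc.IH comm')
qed simp

lemma word_prod_row_word_col_word: "strict_tab t \<Longrightarrow> word_prod (row_word t a b) = word_prod (col_word t a b)"
  by (induction b) (auto simp: word_prod_row_word_Suc col_word_Suc)

lemma rev_col_word: "rev (col_word t a b) = row_word (flip_tab t) b a"
  by (induction b) (auto simp: col_word_Suc row_word_Suc flip_tab_def rev_map)

text \<open>Reversing a column reading gives a row reading of the transposed tableau, and reversing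
  a word inverts its product. This is the source of the symmetry between \<open>w\<close> and
  \<open>inv w\<close>.\<close>

lemma word_prod_row_word_flip_tab:
  assumes "strict_tab t" shows "word_prod (row_word (flip_tab t) b a) = inv (word_prod (row_word t a b))"
  using assms by (simp add: rev_col_word[symmetric] word_prod_rev_inv word_prod_row_word_col_word)

section \<open>Inserting a maximal value\<close>

definition strict_row :: "(nat \<Rightarrow> nat) \<Rightarrow> bool" where
  "strict_row f \<longleftrightarrow> (\<forall>j. f (Suc j) \<noteq> 0 \<longrightarrow> f j \<noteq> 0 \<and> f j < f (Suc j))"

lemma strict_rowD: "strict_row f \<Longrightarrow> f (Suc j) \<noteq> 0 \<Longrightarrow> f j \<noteq> 0 \<and> f j < f (Suc j)"
  unfolding strict_row_def by blast

lemma strict_tab_strict_row: "strict_tab t \<Longrightarrow> strict_row (t i)"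
  unfolding strict_tab_def strict_row_def by blast

lemma strict_row_le: "strict_row f \<Longrightarrow> f (j + k) \<noteq> 0 \<Longrightarrow> f j \<noteq> 0 \<and> f j + k \<le> f (j + k)"
proof (induction k)
  case (Suc k)
  have "f (j + k) \<noteq> 0 \<and> f (j + k) < f (j + Suc k)"
    using strict_rowD[of f "j + k"] Suc.prems by simp
  moreover from this have "f j \<noteq> 0 \<and> f j + k \<le> f (j + k)"
    using Suc.IH Suc.prems(1) by blast
  ultimately show ?case by simp
qed simp

lemma strict_row_zero: "strict_row f \<Longrightarrow> f j = 0 \<Longrightarrow> j \<le> k \<Longrightarrow> f k = 0"
  using strict_row_le[of f j "k - j"] by auto

text \<open>
  The effect of inserting \<open>n - 1, n - 2, \<dots>, q\<close> into a row with letters below \<open>n - 1\<close>; the letters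
  bumped into the next row are \<open>n - 1, \<dots>, q + 1\<close>.
\<close>

definition insert_row :: "nat \<Rightarrow> (nat \<Rightarrow> nat) \<Rightarrow> nat \<Rightarrow> nat" where
  "insert_row q f j = (if f j \<noteq> 0 \<and> f j < q then f j
     else if j = 0 \<or> f (j - 1) \<noteq> 0 \<and> f (j - 1) < q then q
     else if f (j - 1) = 0 then 0 else Suc (f (j - 1)))"

text \<open>The cut \<open>k\<close> separates the letters A below \<open>q\<close> from the letters
  B that are at least \<open>q\<close>; insertion produces A q (B+1). The zero at \<open>M\<close>
  guarantees that a cut exists.\<close>

lemma insert_row_split:
  assumes "strict_row f" "f M = 0"
  shows "\<exists>k\<le>M. (\<forall>j<k. f j \<noteq> 0 \<and> f j < q \<and> insert_row q f j = f j) \<and> insert_row q f k = q \<and>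
    (\<forall>j\<ge>k. (f j = 0 \<or> q \<le> f j) \<and> insert_row q f (Suc j) = (if f j = 0 then 0 else Suc (f j)))"
proof -
  let ?k = "LEAST j. f j = 0 \<or> q \<le> f j"
  have le: "?k \<le> M" by (rule Least_le) (simp add: assms)
  have k: "f ?k = 0 \<or> q \<le> f ?k" by (rule LeastI[of _ M]) (simp add: assms)
  have lt: "f j \<noteq> 0 \<and> f j < q" if "j < ?k" for j
    using not_less_Least[OF that] by auto
  have ge: "f j = 0 \<or> q \<le> f j" if "?k \<le> j" for j
    using strict_row_le[OF assms(1), of ?k "j - ?k"] k that by force
  have 1: "insert_row q f j = f j" if "j < ?k" for j using lt[OF that] by (simp add: insert_row_def)
  have 2: "insert_row q f ?k = q"
    using k lt[of "?k - 1"] by (cases "?k = 0") (auto simp: insert_row_def)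
  have 3: "insert_row q f (Suc j) = (if f j = 0 then 0 else Suc (f j))" if "?k \<le> j" for j
    using ge[OF that] ge[of "Suc j"] that by (auto simp: insert_row_def)
  show ?thesis using le lt ge 1 2 3 by (intro exI[of _ ?k]) blast
qed

text \<open>If \<open>v\<close> fixes \<open>n\<close>, then \<open>v \<circ> cycle_to p n\<close> is \<open>v\<close> with the value \<open>n\<close> moved to position \<open>p\<close>.\<close>

definition cycle_to :: "nat \<Rightarrow> nat \<Rightarrow> nat \<Rightarrow> nat" where
  "cycle_to p n x = (if x = p then n else if p < x \<and> x \<le> n then x - 1 else x)"

lemma word_prod_rev_upt_Suc: "q < n \<Longrightarrow> word_prod (rev [q..<n]) = word_prod (rev [Suc q..<n]) \<circ> adj_swap q"
  by (simp add: upt_conv_Cons)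

lemma word_prod_cycle_to: "0 < p \<Longrightarrow> p \<le> n \<Longrightarrow> word_prod (rev [p..<n]) = cycle_to p n"
proof (induction "n - p" arbitrary: p)
  case 0
  then show ?case by (auto simp: cycle_to_def fun_eq_iff)
next
  case (Suc d)
  then have "word_prod (rev [Suc p..<n]) = cycle_to (Suc p) n" by (intro Suc.hyps) auto
  then show ?case using Suc.hyps(2) Suc.prems
    by (subst word_prod_rev_upt_Suc) (auto simp: cycle_to_def fun_eq_iff adj_swap_apply)
qed

lemma cycle_to_adj_swap: "0 < q \<Longrightarrow> q \<le> r \<Longrightarrow> Suc r < n \<Longrightarrow> adj_swap r \<circ> cycle_to q n = cycle_to q n \<circ> adj_swap (Suc r)"
  by (auto simp: cycle_to_def fun_eq_iff adj_swap_apply)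

lemma word_prod_cycle_to_shift:
  assumes "0 < q" "\<And>x. x \<in> set xs \<Longrightarrow> x = 0 \<or> q \<le> x \<and> Suc x < n"
  shows "word_prod xs \<circ> cycle_to q n = cycle_to q n \<circ> word_prod (map (\<lambda>x. if x = 0 then 0 else Suc x) xs)"
  using assms(2)
proof (induction xs)
  case (Cons x xs)
  have IH: "word_prod xs \<circ> cycle_to q n = cycle_to q n \<circ> word_prod (map (\<lambda>x. if x = 0 then 0 else Suc x) xs)"
    by (rule Cons.IH) (use Cons.prems in auto)
  have x: "adj_swap x \<circ> cycle_to q n = cycle_to q n \<circ> adj_swap (if x = 0 then 0 else Suc x)"
    using Cons.prems[of x] cycle_to_adj_swap[OF assms(1), of x n] by (cases "x = 0") auto
  have "word_prod (x # xs) \<circ> cycle_to q n = adj_swap x \<circ> (word_prod xs \<circ> cycle_to q n)" by (simp add: comp_assoc)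
  also have "\<dots> = (adj_swap x \<circ> cycle_to q n) \<circ> word_prod (map (\<lambda>x. if x = 0 then 0 else Suc x) xs)"
    by (simp only: IH comp_assoc)
  also have "\<dots> = cycle_to q n \<circ> word_prod (map (\<lambda>x. if x = 0 then 0 else Suc x) (x # xs))"
    by (simp only: x comp_assoc list.map word_prod_Cons)
  finally show ?case .
qed simp

lemma word_prod_commute_list:
  assumes "\<And>x y. x \<in> set xs \<Longrightarrow> y \<in> set ys \<Longrightarrow> adj_swap y \<circ> adj_swap x = adj_swap x \<circ> adj_swap y"
  shows "word_prod xs \<circ> word_prod ys = word_prod ys \<circ> word_prod xs"
  using assms
proof (induction ys)
  case (Cons y ys)
  have 1: "adj_swap y \<circ> word_prod xs = word_prod xs \<circ> adj_swap y"
    by (rule word_prod_commute) (rule Cons.prems, simp_all)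
  have 2: "word_prod xs \<circ> word_prod ys = word_prod ys \<circ> word_prod xs"
    by (rule Cons.IH) (rule Cons.prems, simp_all)
  have "word_prod xs \<circ> word_prod (y # ys) = (word_prod xs \<circ> adj_swap y) \<circ> word_prod ys" by (simp add: comp_assoc)
  also have "\<dots> = adj_swap y \<circ> (word_prod xs \<circ> word_prod ys)" by (simp only: 1[symmetric] comp_assoc)
  also have "\<dots> = word_prod (y # ys) \<circ> word_prod xs" by (simp only: 2 comp_assoc word_prod_Cons)
  finally show ?case .
qed simp

text \<open>Write the row as A B, cut at \<open>q\<close>. Moving the descending word to the left
  past B raises the letters of B by one, and its part above \<open>q\<close> commutes with A. What
  stays behind is A q (B+1).\<close>

lemma word_prod_row_insert_row:
  assumes f: "strict_row f" "\<And>j. f j \<noteq> 0 \<Longrightarrow> Suc (f j) < n" and q: "0 < q" "q < n"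
  shows "word_prod (map f [0..<n]) \<circ> word_prod (rev [q..<n]) = word_prod (rev [Suc q..<n]) \<circ> word_prod (map (insert_row q f) [0..<n])"
proof -
  obtain M where M: "n = Suc M" using q by (cases n) auto
  have fM: "f M = 0" using f(2)[of M] strict_row_le[OF f(1), of 0 M] M by fastforce
  obtain k where k: "k \<le> M" "\<And>j. j < k \<Longrightarrow> f j \<noteq> 0 \<and> f j < q"
    "\<And>j. k \<le> j \<Longrightarrow> f j = 0 \<or> q \<le> f j"
    "\<And>j. j < k \<Longrightarrow> insert_row q f j = f j" "insert_row q f k = q"
    "\<And>j. k \<le> j \<Longrightarrow> insert_row q f (Suc j) = (if f j = 0 then 0 else Suc (f j))"
    using insert_row_split[OF f(1) fM, of q] by blast
  let ?g = "\<lambda>x. if x = 0 then 0 else Suc x"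
  let ?A = "map f [0..<k]" and ?B = "map f [k..<M]"
  have *: "[0..<M] = [0..<k] @ [k..<M]"
    using upt_add_eq_append[of 0 k "M - k"] k(1) by simp
  have 1: "word_prod (map f [0..<n]) = word_prod ?A \<circ> word_prod ?B"
    by (simp add: M fM *)
  have **: "[0..<n] = [0..<k] @ k # map Suc [k..<M]"
    using upt_add_eq_append[of 0 k "n - k"] k(1) upt_conv_Cons[of k n] by (simp add: M map_Suc_upt)
  have 2: "map (insert_row q f) [0..<n] = ?A @ q # map ?g ?B"
    unfolding ** using k(4-6) by auto
  have 3: "word_prod ?A \<circ> word_prod (rev [Suc q..<n]) = word_prod (rev [Suc q..<n]) \<circ> word_prod ?A"
  proof (rule word_prod_commute_list)
    fix x y assume "x \<in> set ?A" "y \<in> set (rev [Suc q..<n])"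
    then have "x + 2 \<le> y" using k(2) by fastforce
    then show "adj_swap y \<circ> adj_swap x = adj_swap x \<circ> adj_swap y" by (rule adj_swap_commute[symmetric])
  qed
  have 4: "word_prod ?B \<circ> word_prod (rev [q..<n]) = word_prod (rev [q..<n]) \<circ> word_prod (map ?g ?B)"
    unfolding word_prod_cycle_to[OF q(1) less_imp_le[OF q(2)]]
  proof (rule word_prod_cycle_to_shift[OF q(1)])
    fix x assume "x \<in> set ?B"
    then obtain j where "k \<le> j" "x = f j" by auto
    then show "x = 0 \<or> q \<le> x \<and> Suc x < n" using k(3)[of j] f(2)[of j] by auto
  qed
  have "word_prod (map f [0..<n]) \<circ> word_prod (rev [q..<n]) = word_prod ?A \<circ> (word_prod ?B \<circ> word_prod (rev [q..<n]))"
    by (simp only: 1 comp_assoc)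
  also have "\<dots> = (word_prod ?A \<circ> word_prod (rev [Suc q..<n])) \<circ> adj_swap q \<circ> word_prod (map ?g ?B)"
    by (simp only: 4) (simp only: comp_assoc word_prod_rev_upt_Suc[OF q(2)])
  also have "\<dots> = word_prod (rev [Suc q..<n]) \<circ> (word_prod ?A \<circ> (adj_swap q \<circ> word_prod (map ?g ?B)))"
    by (simp only: 3 comp_assoc)
  also have "word_prod ?A \<circ> (adj_swap q \<circ> word_prod (map ?g ?B)) = word_prod (map (insert_row q f) [0..<n])"
    unfolding 2 by (simp only: word_prod_append word_prod_Cons)
  finally show ?thesis .
qed

lemma insert_row_neq_0: "strict_row f \<Longrightarrow> 0 < q \<Longrightarrow> insert_row q f j \<noteq> 0 \<longleftrightarrow> j = 0 \<or> f (j - 1) \<noteq> 0"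
  using strict_rowD[of f "j - 1"] by (cases "f j = 0"; cases j) (auto simp: insert_row_def)

text \<open>The letter \<open>q\<close> stands exactly at the cut, after smaller letters only, so
  the cut and then both halves of the row can be recovered.\<close>

lemma insert_row_inj:
  assumes "strict_row f" "strict_row g" "f M = 0" "g M = 0" "insert_row q f = insert_row q g"
  shows "f = g"
proof -
  obtain k where k: "k \<le> M" "\<And>j. j < k \<Longrightarrow> f j \<noteq> 0 \<and> f j < q"
    "\<And>j. k \<le> j \<Longrightarrow> f j = 0 \<or> q \<le> f j"
    "\<And>j. j < k \<Longrightarrow> insert_row q f j = f j" "insert_row q f k = q"
    "\<And>j. k \<le> j \<Longrightarrow> insert_row q f (Suc j) = (if f j = 0 then 0 else Suc (f j))"
    using insert_row_split[OF assms(1,3), of q] by blast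
  obtain l where l: "l \<le> M" "\<And>j. j < l \<Longrightarrow> g j \<noteq> 0 \<and> g j < q"
    "\<And>j. l \<le> j \<Longrightarrow> g j = 0 \<or> q \<le> g j"
    "\<And>j. j < l \<Longrightarrow> insert_row q g j = g j" "insert_row q g l = q"
    "\<And>j. l \<le> j \<Longrightarrow> insert_row q g (Suc j) = (if g j = 0 then 0 else Suc (g j))"
    using insert_row_split[OF assms(2,4), of q] by blast
  have "\<not> k < l" using k(5) l(2)[of k] l(4)[of k] assms(5) by auto
  moreover have "\<not> l < k" using l(5) k(2)[of l] k(4)[of l] assms(5) by auto
  ultimately have kl: "l = k" by simp
  show ?thesis
  proof
    fix j
    show "f j = g j"
    proof (cases "j < k")
      case True
      then show ?thesis using k(4)[of j] l(4)[of j] kl assms(5) by simp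
    next
      case False
      then show ?thesis using k(6)[of j] l(6)[of j] kl assms(5) by (auto split: if_splits)
    qed
  qed
qed

lemma strict_row_insert_row: "strict_row f \<Longrightarrow> 0 < q \<Longrightarrow> strict_row (insert_row q f)"
  unfolding strict_row_def[of "insert_row q f"]
proof (intro allI impI)
  fix j assume f: "strict_row f" "0 < q" and j: "insert_row q f (Suc j) \<noteq> 0"
  have fj: "f j \<noteq> 0" using j insert_row_neq_0[OF f] by simp
  have "j = 0 \<or> f (j - 1) \<noteq> 0 \<and> f (j - 1) < f j"
    using strict_rowD[OF f(1), of "j - 1"] fj by (cases j) auto
  then show "insert_row q f j \<noteq> 0 \<and> insert_row q f j < insert_row q f (Suc j)"
    using strict_rowD[OF f(1), of j] fj f(2) by (auto simp: insert_row_def)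
qed

text \<open>A letter of \<open>g\<close> below \<open>Suc q\<close> has a letter below
  \<open>q\<close> above it, so the cut of the lower row is weakly left of the cut of the upper row.
  Left of both cuts nothing changes, right of both the rows shift alike, and in between the upper
  entry is at most \<open>q\<close> and the lower one at least \<open>Suc q\<close>.\<close>

lemma strict_col_insert_row:
  assumes "strict_row f" "strict_row g" "\<And>j. g j \<noteq> 0 \<Longrightarrow> f j \<noteq> 0 \<and> f j < g j" "0 < q"
    and "insert_row (Suc q) g j \<noteq> 0"
  shows "insert_row q f j \<noteq> 0 \<and> insert_row q f j < insert_row (Suc q) g j"
proof -
  have g: "j = 0 \<or> g (j - 1) \<noteq> 0" using assms(5) insert_row_neq_0[OF assms(2)] by simp
  have f: "j = 0 \<or> f (j - 1) \<noteq> 0 \<and> f (j - 1) < g (j - 1)" using g assms(3) by auto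
  have "f j \<noteq> 0 \<Longrightarrow> j = 0 \<or> f (j - 1) < f j" "g j \<noteq> 0 \<Longrightarrow> j = 0 \<or> g (j - 1) < g j"
    using strict_rowD[OF assms(1), of "j - 1"] strict_rowD[OF assms(2), of "j - 1"] by (cases j; auto)+
  then show ?thesis using g f assms(3)[of j] assms(4)
    by (auto simp: insert_row_def)
qed

text \<open>Row \<open>i\<close> receives the letters \<open>n - 1\<close> down to
  \<open>p + i\<close> and passes on one letter fewer, so the process dies out after
  \<open>n - p\<close> rows.\<close>

definition insert_max :: "nat \<Rightarrow> nat \<Rightarrow> (nat \<Rightarrow> nat \<Rightarrow> nat) \<Rightarrow> nat \<Rightarrow> nat \<Rightarrow> nat" where
  "insert_max p n t i = (if p + i < n then insert_row (p + i) (t i) else t i)"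

definition entries_below :: "nat \<Rightarrow> (nat \<Rightarrow> nat \<Rightarrow> nat) \<Rightarrow> bool" where
  "entries_below n t \<longleftrightarrow> (\<forall>i j. t i j \<noteq> 0 \<longrightarrow> t i j < n)"

text \<open>The top left entry is at least 1 and each step right or down adds at least 1, so a
  nonzero entry at \<open>(i, j)\<close> is at least \<open>i + j + 1\<close>; hence the
  \<open>Suc\<close>.\<close>

lemma entries_below_zero:
  assumes "strict_tab t" "entries_below n t" "n \<le> Suc (i + j)" shows "t i j = 0"
proof (rule ccontr)
  assume "t i j \<noteq> 0"
  then show False using strict_tab_le[of t i j 0 0] assms unfolding entries_below_def by fastforce
qed

lemma strict_tab_insert_max:
  assumes "strict_tab t" "entries_below (n - 1) t" "0 < p"
  shows "strict_tab (insert_max p n t)"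
proof -
  have row: "strict_row (insert_max p n t i)" for i
    using strict_tab_strict_row[OF assms(1)] assms(3) by (auto simp: insert_max_def strict_row_insert_row)
  have col: "insert_max p n t i j \<noteq> 0 \<and> insert_max p n t i j < insert_max p n t (Suc i) j"
    if "insert_max p n t (Suc i) j \<noteq> 0" for i j
  proof (cases "p + Suc i < n")
    case True
    then show ?thesis
      using strict_col_insert_row[of "t i" "t (Suc i)" "p + i" j] that strict_tab_strict_row[OF assms(1)]
        strict_tab_colD[OF assms(1)] assms(3) by (simp add: insert_max_def)
  next
    case False
    then have *: "t (Suc i) j \<noteq> 0" "insert_max p n t (Suc i) j = t (Suc i) j"
      using that by (auto simp: insert_max_def)
    then have "t i j \<noteq> 0" "t i j < t (Suc i) j" using strict_tab_colD[OF assms(1)] by auto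
    \<comment> \<open>The boundary of the changed rows: the lower entry is below
      \<open>n - 1\<close>, which is at most \<open>p + i\<close>, so the entry above it lies left
      of its cut and is unchanged.\<close>
    moreover have "t (Suc i) j < n - 1" using * assms(2) by (auto simp: entries_below_def)
    ultimately show ?thesis using False * by (auto simp: insert_max_def insert_row_def)
  qed
  show ?thesis unfolding strict_tab_def using row col unfolding strict_row_def by blast
qed

lemma entries_below_insert_max: "entries_below (n - 1) t \<Longrightarrow> entries_below n (insert_max p n t)"
  unfolding entries_below_def
proof (intro allI impI)
  fix i j assume b: "\<forall>i j. t i j \<noteq> 0 \<longrightarrow> t i j < n - 1" and nz: "insert_max p n t i j \<noteq> 0"
  have *: "t i j = 0 \<or> Suc (t i j) < n" for i j using b[rule_format, of i j] by linarith
  show "insert_max p n t i j < n"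
  proof (cases "p + i < n")
    case True
    then show ?thesis using *[of i j] *[of i "j - 1"] by (auto simp: insert_max_def insert_row_def)
  next
    case False
    then show ?thesis using *[of i j] nz by (auto simp: insert_max_def)
  qed
qed

lemma insert_max_inj:
  assumes "strict_tab t" "strict_tab s" "entries_below m t" "entries_below m s" "insert_max p n t = insert_max p n s"
  shows "t = s"
proof
  fix i
  have "insert_max p n t i = insert_max p n s i" using assms(5) by simp
  then show "t i = s i"
    using insert_row_inj[OF strict_tab_strict_row[OF assms(1)] strict_tab_strict_row[OF assms(2)], of i m i "p + i"]
      entries_below_zero[OF assms(1,3), of i m] entries_below_zero[OF assms(2,4), of i m]
    by (auto simp: insert_max_def split: if_splits)
qed

lemma word_prod_row_word_insert_max:
  assumes t: "strict_tab t" "entries_below (n - 1) t" and p: "0 < p" "p \<le> n"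
  shows "word_prod (row_word (insert_max p n t) n n) = word_prod (row_word t n n) \<circ> cycle_to p n"
proof -
  \<comment> \<open>The invariant after \<open>a\<close> rows: the letters still to be inserted are
    \<open>n - 1\<close> down to \<open>p + a\<close>, and they now stand to the left of the rows
    already treated.\<close>
  have 1: "word_prod (row_word t a n) \<circ> word_prod (rev [p..<n]) = word_prod (rev [p + a..<n]) \<circ> word_prod (row_word (insert_max p n t) a n)"
    if "p + a \<le> n" for a
    using that
  proof (induction a)
    case (Suc a)
    have r: "word_prod (map (t a) [0..<n]) \<circ> word_prod (rev [p + a..<n]) =
        word_prod (rev [Suc (p + a)..<n]) \<circ> word_prod (map (insert_row (p + a) (t a)) [0..<n])"
    proof (rule word_prod_row_insert_row)
      show "Suc (t a j) < n" if "t a j \<noteq> 0" for j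
        using t(2) that less_diff_conv[of "t a j" n 1] by (simp add: entries_below_def)
    qed (use strict_tab_strict_row[OF t(1)] Suc.prems p in auto)
    have "word_prod (row_word t (Suc a) n) \<circ> word_prod (rev [p..<n]) =
        word_prod (map (t a) [0..<n]) \<circ> (word_prod (row_word t a n) \<circ> word_prod (rev [p..<n]))"
      by (simp only: row_word_Suc word_prod_append comp_assoc)
    also have "\<dots> = (word_prod (map (t a) [0..<n]) \<circ> word_prod (rev [p + a..<n])) \<circ> word_prod (row_word (insert_max p n t) a n)"
      using Suc by (simp only: comp_assoc)
    also have "\<dots> = word_prod (rev [p + Suc a..<n]) \<circ> word_prod (row_word (insert_max p n t) (Suc a) n)"
      using Suc.prems unfolding r by (simp add: row_word_Suc comp_assoc insert_max_def)
    finally show ?case .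
  qed simp
  have 2: "word_prod (row_word t (n - p + d) n) \<circ> word_prod (rev [p..<n]) = word_prod (row_word (insert_max p n t) (n - p + d) n)" for d
  proof (induction d)
    case 0
    then show ?case using 1[of "n - p"] p by simp
  next
    case (Suc d)
    have "word_prod (row_word t (n - p + Suc d) n) \<circ> word_prod (rev [p..<n]) =
        word_prod (map (t (n - p + d)) [0..<n]) \<circ> (word_prod (row_word t (n - p + d) n) \<circ> word_prod (rev [p..<n]))"
      by (simp only: add_Suc_right row_word_Suc word_prod_append comp_assoc)
    moreover have "insert_max p n t (n - p + d) = t (n - p + d)" using p by (simp add: insert_max_def)
    ultimately show ?case unfolding Suc by (simp only: add_Suc_right row_word_Suc word_prod_append)
  qed
  show ?thesis using 2[of p] word_prod_cycle_to[OF p] p by simp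
qed

section \<open>Reduced tableaux of a permutation\<close>

definition row_len :: "(nat \<Rightarrow> nat \<Rightarrow> nat) \<Rightarrow> nat \<Rightarrow> nat" where
  "row_len t i = card {j. t i j \<noteq> 0}"

lemma row_support:
  assumes "strict_tab t" "entries_below n t" shows "{j. t i j \<noteq> 0} \<subseteq> {..<n}"
proof
  fix j assume "j \<in> {j. t i j \<noteq> 0}"
  then show "j \<in> {..<n}" using entries_below_zero[OF assms, of i j] by (cases "j < n") auto
qed

lemma finite_row: "strict_tab t \<Longrightarrow> entries_below n t \<Longrightarrow> finite {j. t i j \<noteq> 0}"
  using finite_subset[OF row_support[of t n i]] by simp

lemma row_len_zero: "strict_tab t \<Longrightarrow> entries_below n t \<Longrightarrow> n \<le> Suc i \<Longrightarrow> row_len t i = 0"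
  using entries_below_zero[of t n i] by (simp add: row_len_def)

lemma row_initial:
  assumes "strict_tab t" "entries_below n t"
  shows "{j. t i j \<noteq> 0} = {..<row_len t i}"
proof -
  let ?A = "{j. t i j \<noteq> 0}"
  let ?k = "LEAST j. t i j = 0"
  have z: "t i n = 0" using entries_below_zero[OF assms, of i n] by simp
  have "?A = {..<?k}"
  proof (intro set_eqI iffI)
    fix j assume "j \<in> ?A"
    moreover have "t i ?k = 0" using z by (rule LeastI)
    ultimately show "j \<in> {..<?k}"
      using strict_row_zero[OF strict_tab_strict_row[OF assms(1)], of i ?k j] by (cases "?k \<le> j") auto
  next
    fix j assume "j \<in> {..<?k}"
    then show "j \<in> ?A" using not_less_Least[of j "\<lambda>j. t i j = 0"] by simp
  qed
  then show ?thesis unfolding row_len_def by simp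
qed

lemma nz_iff_row_len: "strict_tab t \<Longrightarrow> entries_below n t \<Longrightarrow> t i j \<noteq> 0 \<longleftrightarrow> j < row_len t i"
  using row_initial[of t n i] by (simp add: set_eq_iff)

lemma row_len_insert_max:
  assumes "strict_tab t" "entries_below m t" "0 < p"
  shows "row_len (insert_max p n t) i = row_len t i + (if p + i < n then 1 else 0)"
proof (cases "p + i < n")
  case True
  have "{j. insert_max p n t i j \<noteq> 0} = insert 0 (Suc ` {j. t i j \<noteq> 0})"
  proof (intro set_eqI)
    fix j
    show "j \<in> {j. insert_max p n t i j \<noteq> 0} \<longleftrightarrow> j \<in> insert 0 (Suc ` {j. t i j \<noteq> 0})"
      using True insert_row_neq_0[OF strict_tab_strict_row[OF assms(1)], of "p + i" i j] assms(3)
      by (cases j) (auto simp: insert_max_def)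
  qed
  then show ?thesis using True finite_row[OF assms(1,2), of i]
    by (simp add: row_len_def card_image card_insert_if)
qed (simp add: row_len_def insert_max_def)

lemma adj_swap_adj_swap_apply [simp]: "adj_swap x (adj_swap x a) = a"
  by (auto simp: adj_swap_apply)

section \<open>Inversions as the length of a permutation\<close>

definition inversions :: "(nat \<Rightarrow> nat) \<Rightarrow> (nat \<times> nat) set" where
  "inversions w = {(a, b). a < b \<and> w b < w a}"

abbreviation inv_count :: "(nat \<Rightarrow> nat) \<Rightarrow> nat" where
  "inv_count w \<equiv> card (inversions w)"

lemma permutes_out:
  assumes "w permutes {1..n::nat}" shows "n < a \<Longrightarrow> w a = a" "w 0 = 0"
  by (rule permutes_not_in[OF assms]; simp)+

lemma permutes_in: "w permutes {1..n} \<Longrightarrow> 0 < a \<Longrightarrow> a \<le> n \<Longrightarrow> 0 < w a \<and> w a \<le> (n::nat)"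
  using permutes_in_image[of w "{1..n}" a] by auto

lemma permutes_le: "w permutes {1..n} \<Longrightarrow> a \<le> n \<Longrightarrow> w a \<le> (n::nat)"
  using permutes_in[of w n a] permutes_out(2)[of w n] by (cases "a = 0") auto

lemma finite_inversions: assumes "w permutes {1..n}" shows "finite (inversions w)"
proof (rule finite_subset)
  show "inversions w \<subseteq> {..n} \<times> {..n}"
  proof (clarsimp simp: inversions_def)
    fix a b assume ab: "a < b" "w b < w a"
    have "b \<le> n"
    proof (rule ccontr)
      assume "\<not> b \<le> n"
      then show False using ab permutes_out(1)[OF assms, of b] permutes_out(1)[OF assms, of a]
          permutes_le[OF assms, of a] by (cases "a \<le> n") auto
    qed
    then show "a \<le> n \<and> b \<le> n" using ab by auto
  qed
qed simp

lemma inversions_adj_swap: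
  assumes "x \<noteq> 0"
  shows "inversions (w \<circ> adj_swap x) - {(x, Suc x)} = (\<lambda>(a, b). (adj_swap x a, adj_swap x b)) ` (inversions w - {(x, Suc x)})"
proof -
  have mono: "adj_swap x a < adj_swap x b" if "a < b" "(a, b) \<noteq> (x, Suc x)" for a b
    using that assms by (auto simp: adj_swap_apply)
  have sub: "(adj_swap x a, adj_swap x b) \<in> inversions (w \<circ> adj_swap x) - {(x, Suc x)}" if "(a, b) \<in> inversions w - {(x, Suc x)}" for a b w
    using that mono[of a b] assms by (auto simp: inversions_def) (auto simp: adj_swap_apply split: if_splits)
  show ?thesis
  proof (intro set_eqI iffI)
    fix y assume y: "y \<in> inversions (w \<circ> adj_swap x) - {(x, Suc x)}"
    obtain a b where ab: "y = (a, b)" by (cases y)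
    have "w \<circ> adj_swap x \<circ> adj_swap x = w" by (simp only: comp_assoc adj_swap_adj_swap comp_id)
    then have "(adj_swap x a, adj_swap x b) \<in> inversions w - {(x, Suc x)}" using sub[of a b "w \<circ> adj_swap x"] y ab by simp
    then show "y \<in> (\<lambda>(a, b). (adj_swap x a, adj_swap x b)) ` (inversions w - {(x, Suc x)})"
      using ab by (force intro: image_eqI[of _ _ "(adj_swap x a, adj_swap x b)"])
  qed (use sub in auto)
qed

lemma inj_adj_swap_pair: "inj_on (\<lambda>(a, b). (adj_swap x a, adj_swap x b)) A"
proof (rule inj_on_inverseI)
  fix y show "(\<lambda>(a, b). (adj_swap x a, adj_swap x b)) ((\<lambda>(a, b). (adj_swap x a, adj_swap x b)) y) = y"
    by (auto split: prod.splits)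
qed

lemma finite_inversions_adj_swap: "finite (inversions w) \<Longrightarrow> finite (inversions (w \<circ> adj_swap x))"
proof (cases "x = 0")
  case False
  assume "finite (inversions w)"
  then have "finite (inversions (w \<circ> adj_swap x) - {(x, Suc x)})" unfolding inversions_adj_swap[OF False] by simp
  then show ?thesis by simp
qed simp

lemma inv_count_adj_swap_eq: "x \<noteq> 0 \<Longrightarrow> card (inversions (w \<circ> adj_swap x) - {(x, Suc x)}) = card (inversions w - {(x, Suc x)})"
  unfolding inversions_adj_swap by (intro card_image inj_adj_swap_pair)

lemma inv_count_adj_swap_up:
  assumes "finite (inversions w)" "x \<noteq> 0" "w x < w (Suc x)"
  shows "inv_count (w \<circ> adj_swap x) = Suc (inv_count w)"
proof -
  have "(x, Suc x) \<in> inversions (w \<circ> adj_swap x)" "(x, Suc x) \<notin> inversions w"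
    using assms by (auto simp: inversions_def adj_swap_apply)
  then show ?thesis using inv_count_adj_swap_eq[OF assms(2), of w] finite_inversions_adj_swap[OF assms(1), of x]
    by (metis Diff_empty Diff_insert0 card_Suc_Diff1)
qed

lemma inv_count_adj_swap_le: "finite (inversions w) \<Longrightarrow> inv_count (w \<circ> adj_swap x) \<le> Suc (inv_count w)"
proof (cases "x = 0")
  case False
  assume f: "finite (inversions w)"
  have "inv_count (w \<circ> adj_swap x) \<le> Suc (card (inversions (w \<circ> adj_swap x) - {(x, Suc x)}))"
    using finite_inversions_adj_swap[OF f, of x] by (metis card_Suc_Diff1 Diff_insert0 Diff_empty le_Suc_eq order_refl)
  also have "\<dots> \<le> Suc (inv_count w)" unfolding inv_count_adj_swap_eq[OF False] using f by (simp add: card_mono)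
  finally show ?thesis .
qed simp

lemma inv_count_word_prod: "finite (inversions (word_prod xs)) \<and> inv_count (word_prod xs) \<le> length (filter (\<lambda>x. x \<noteq> 0) xs)"
proof (induction xs rule: rev_induct)
  case Nil
  have "inversions (word_prod []) = {}" by (auto simp: inversions_def)
  then show ?case by (simp del: word_prod_Nil)
next
  case (snoc x xs)
  have e: "word_prod (xs @ [x]) = word_prod xs \<circ> adj_swap x" by simp
  show ?case
  proof (cases "x = 0")
    case True
    then show ?thesis unfolding e using snoc by simp
  next
    case False
    then have "length (filter (\<lambda>x. x \<noteq> 0) (xs @ [x])) = Suc (length (filter (\<lambda>x. x \<noteq> 0) xs))" by simp
    then show ?thesis unfolding e
      using snoc finite_inversions_adj_swap[of "word_prod xs" x] inv_count_adj_swap_le[of "word_prod xs" x] by linarith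
  qed
qed

lemma permutes_cycle_to: "0 < p \<Longrightarrow> p \<le> n \<Longrightarrow> cycle_to p n permutes {1..n}"
proof (rule bij_imp_permutes)
  assume p: "0 < p" "p \<le> n"
  have "inj_on (cycle_to p n) {1..n}" by (auto simp: inj_on_def cycle_to_def split: if_splits)
  moreover have "cycle_to p n ` {1..n} \<subseteq> {1..n}" using p by (auto simp: cycle_to_def)
  ultimately show "bij_betw (cycle_to p n) {1..n} {1..n}"
    by (simp add: bij_betw_def endo_inj_surj)
qed (auto simp: cycle_to_def)

text \<open>As \<open>v\<close> fixes \<open>n\<close>, each adjacent swap carries the value
  \<open>n\<close> one place to the left past a smaller value and creates one inversion.\<close>

lemma inv_count_cycle_to:
  assumes v: "v permutes {1..n - 1}" and "0 < p" "p \<le> n"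
  shows "inv_count (v \<circ> cycle_to p n) = inv_count v + (n - p)"
  using assms(2,3)
proof (induction "n - p" arbitrary: p)
  case 0
  then have "cycle_to p n = id" by (auto simp: cycle_to_def fun_eq_iff)
  then show ?case using 0 by simp
next
  case (Suc d)
  have p: "0 < p" "p < n" "d = n - Suc p" "n - p = Suc (n - Suc p)" using Suc.hyps(2) Suc.prems by linarith+
  have IH: "inv_count (v \<circ> cycle_to (Suc p) n) = inv_count v + (n - Suc p)"
    using Suc.hyps(1)[OF p(3)] p(2) by simp
  have v': "v permutes {1..n}" by (rule permutes_subset[OF v]) auto
  have e: "v \<circ> cycle_to p n = v \<circ> cycle_to (Suc p) n \<circ> adj_swap p"
    using word_prod_rev_upt_Suc[OF p(2)] p(1,2) word_prod_cycle_to[of p n] word_prod_cycle_to[of "Suc p" n] by (simp add: comp_assoc)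
  have "inv_count (v \<circ> cycle_to (Suc p) n \<circ> adj_swap p) = Suc (inv_count (v \<circ> cycle_to (Suc p) n))"
  proof (rule inv_count_adj_swap_up)
    have "cycle_to (Suc p) n permutes {1..n}" using p(2) by (intro permutes_cycle_to) auto
    then show "finite (inversions (v \<circ> cycle_to (Suc p) n))"
      using v' by (intro finite_inversions[of _ n] permutes_compose)
    have "v p \<le> n - 1" using permutes_le[OF v, of p] p(2) by linarith
    moreover have "v n = n" using permutes_out(1)[OF v, of n] p(2) by linarith
    ultimately show "(v \<circ> cycle_to (Suc p) n) p < (v \<circ> cycle_to (Suc p) n) (Suc p)"
      using p(2) by (simp add: cycle_to_def)
  qed (use p(1) in simp)
  then show ?case unfolding e IH p(4) by simp
qed

lemma inv_count_inv:
  assumes "w permutes {1..n}" shows "inv_count (inv w) = inv_count w"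
proof -
  have w: "inv w (w a) = a" "w (inv w a) = a" for a
    using permutes_inverses[OF assms] by auto
  have "bij_betw (\<lambda>(a, b). (w b, w a)) (inversions w) (inversions (inv w))"
  proof (rule bij_betw_byWitness[where f' = "\<lambda>(a, b). (inv w b, inv w a)"])
    show "\<forall>a\<in>inversions w. (case case a of (a, b) \<Rightarrow> (w b, w a) of (a, b) \<Rightarrow> (inv w b, inv w a)) = a"
      "\<forall>a'\<in>inversions (inv w). (case case a' of (a, b) \<Rightarrow> (inv w b, inv w a) of (a, b) \<Rightarrow> (w b, w a)) = a'"
      "(\<lambda>(a, b). (w b, w a)) ` inversions w \<subseteq> inversions (inv w)"
      "(\<lambda>(a, b). (inv w b, inv w a)) ` inversions (inv w) \<subseteq> inversions w"
      by (auto simp: w inversions_def)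
  qed
  then show ?thesis using bij_betw_same_card by metis
qed

text \<open>Reducedness is expressed through the shape, as many cells as inversions, because
  insertion controls row lengths directly.\<close>

definition red_tabs :: "nat \<Rightarrow> (nat \<Rightarrow> nat) \<Rightarrow> (nat \<Rightarrow> nat \<Rightarrow> nat) set" where
  "red_tabs n w = {t. strict_tab t \<and> entries_below n t \<and> word_prod (row_word t n n) = w \<and> (\<Sum>i<n. row_len t i) = inv_count w}"

lemma entries_below_flip_tab [simp]: "entries_below n (flip_tab t) = entries_below n t"
  by (auto simp: entries_below_def flip_tab_def)

lemma sum_row_len: 
  assumes "strict_tab t" "entries_below n t" shows "(\<Sum>i<n. row_len t i) = card {(i, j). t i j \<noteq> 0}"
proof -
  have "i < n" if "t i j \<noteq> 0" for i j
    using entries_below_zero[OF assms, of i j] that by (cases "i < n") auto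
  then have "{(i, j). t i j \<noteq> 0} = (SIGMA i:{..<n}. {j. t i j \<noteq> 0})"
    unfolding lessThan_def by blast
  then show ?thesis using finite_row[OF assms] by (simp add: row_len_def)
qed

lemma sum_row_len_flip_tab:
  assumes "strict_tab t" "entries_below n t" shows "(\<Sum>i<n. row_len (flip_tab t) i) = (\<Sum>i<n. row_len t i)"
proof -
  have "{(i, j). flip_tab t i j \<noteq> 0} = prod.swap ` {(i, j). t i j \<noteq> 0}"
    by (auto simp: flip_tab_def image_iff)
  then show ?thesis using assms sum_row_len[of t n] sum_row_len[of "flip_tab t" n]
    by (simp add: card_image)
qed

lemma red_tabs_flip_tab:
  assumes "w permutes {1..n}" "t \<in> red_tabs n w" shows "flip_tab t \<in> red_tabs n (inv w)"
proof -
  have t: "strict_tab t" "entries_below n t" "word_prod (row_word t n n) = w" "(\<Sum>i<n. row_len t i) = inv_count w"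
    using assms(2) unfolding red_tabs_def by blast+
  show ?thesis
    using t sum_row_len_flip_tab[OF t(1,2)] word_prod_row_word_flip_tab[OF t(1), of n n] inv_count_inv[OF assms(1)]
    unfolding red_tabs_def by simp
qed

lemma word_prod_zeros: "\<forall>x\<in>set xs. x = 0 \<Longrightarrow> word_prod xs = id"
  by (induction xs) auto

lemma word_prod_row_word_stable:
  assumes "strict_tab t" "entries_below n t" shows "word_prod (row_word t (Suc n) (Suc n)) = word_prod (row_word t n n)"
proof -
  have z: "t n j = 0" "t j n = 0" for j
    using entries_below_zero[OF assms, of n j] entries_below_zero[OF assms, of j n] by auto
  have "word_prod (map (\<lambda>i. t i n) (rev [0..<n])) = id" by (rule word_prod_zeros) (auto simp: z)
  moreover have "word_prod (map (t n) [0..<Suc n]) = id" by (rule word_prod_zeros) (auto simp: z)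
  ultimately show ?thesis
    unfolding row_word_Suc[of t n] word_prod_append word_prod_row_word_Suc[OF assms(1)] by simp
qed

lemma entries_belowD: "entries_below n t \<Longrightarrow> t i j \<noteq> 0 \<Longrightarrow> t i j < n"
  unfolding entries_below_def by blast

lemma sum_if_less: "p + n' = n \<Longrightarrow> n' \<le> m \<Longrightarrow> (\<Sum>i<m. if p + i < n then 1 else 0) = (n'::nat)"
proof -
  assume "p + n' = n" "n' \<le> m"
  then have "{..<m} \<inter> {i. p + i < n} = {..<n'}" by auto
  then show ?thesis by (simp add: sum.If_cases)
qed

lemma red_tabs_insert_max:
  assumes "v permutes {1..n - 1}" "t \<in> red_tabs (n - 1) v" "0 < p" "p \<le> n"
  shows "insert_max p n t \<in> red_tabs n (v \<circ> cycle_to p n)"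
proof -
  have t: "strict_tab t" "entries_below (n - 1) t" "word_prod (row_word t (n - 1) (n - 1)) = v" "(\<Sum>i<n - 1. row_len t i) = inv_count v"
    using assms(2) unfolding red_tabs_def by blast+
  obtain m where n: "n = Suc m" using assms(3,4) by (cases n) auto
  have "word_prod (row_word t n n) = word_prod (row_word t m m)"
    using word_prod_row_word_stable[OF t(1), of m] t(2) unfolding n by simp
  then have 1: "word_prod (row_word t n n) = v" using t(3) unfolding n by simp
  have "(\<Sum>i<n. row_len t i) = (\<Sum>i<n - 1. row_len t i)"
    using row_len_zero[OF t(1,2), of m] unfolding n by simp
  then have "(\<Sum>i<n. row_len (insert_max p n t) i) = inv_count v + (n - p)"
    unfolding row_len_insert_max[OF t(1,2) assms(3)] sum.distrib t(4)
    using sum_if_less[of p "n - p" n n] assms(4) by simp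
  moreover note strict_tab_insert_max[OF t(1,2) assms(3)] entries_below_insert_max[OF t(2), of p]
    word_prod_row_word_insert_max[OF t(1,2) assms(3,4)] inv_count_cycle_to[OF assms(1,3,4)]
  ultimately show ?thesis unfolding red_tabs_def 1 by simp
qed

section \<open>Comparison with the tableaux of the statement\<close>

definition tab_rows :: "(nat \<Rightarrow> nat \<Rightarrow> nat) \<Rightarrow> nat list list" where
  "tab_rows t = map (\<lambda>i. map (t i) [0..<row_len t i]) [0..<row_len (flip_tab t) 0]"

lemma nz_col: "strict_tab t \<Longrightarrow> entries_below n t \<Longrightarrow> t i j \<noteq> 0 \<longleftrightarrow> i < row_len (flip_tab t) j"
  using nz_iff_row_len[of "flip_tab t" n j i] by (simp add: flip_tab_def)

lemma row_len_antimono: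
  assumes "strict_tab t" "entries_below n t" "i \<le> i'" shows "row_len t i' \<le> row_len t i"
proof (rule ccontr)
  assume "\<not> row_len t i' \<le> row_len t i"
  then have "t i' (row_len t i) \<noteq> 0" using nz_iff_row_len[OF assms(1,2), of i' "row_len t i"] by simp
  then have "t i (row_len t i) \<noteq> 0" using strict_tab_le(1)[OF assms(1), of i' "row_len t i" i "row_len t i"] assms(3) by simp
  then show False using nz_iff_row_len[OF assms(1,2), of i "row_len t i"] by simp
qed

lemma transpose_tab_rows:
  assumes "strict_tab t" "entries_below n t"
  shows "List.transpose (tab_rows t) = map (\<lambda>j. map (\<lambda>i. t i j) [0..<row_len (flip_tab t) j]) [0..<row_len t 0]"
proof -
  let ?c = "row_len (flip_tab t) 0"
  have sorted: "sorted (rev (map length (tab_rows t)))"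
    unfolding rev_map[symmetric]
    by (auto simp: tab_rows_def sorted_iff_nth_mono rev_nth intro!: row_len_antimono[OF assms])
  have c: "row_len t 0 \<noteq> 0 \<Longrightarrow> ?c \<noteq> 0" "row_len t 0 = 0 \<Longrightarrow> ?c = 0"
    using nz_iff_row_len[OF assms, of 0 0] nz_col[OF assms, of 0 0] by auto
  have len: "length (List.transpose (tab_rows t)) = row_len t 0"
  proof (cases "row_len t 0 = 0")
    case True
    then show ?thesis using c by (simp add: tab_rows_def)
  next
    case False
    then have "tab_rows t \<noteq> []" "length (tab_rows t ! 0) = row_len t 0" using c by (auto simp: tab_rows_def)
    then show ?thesis using length_transpose_sorted[OF sorted] by auto
  qed
  have col: "length (filter (\<lambda>ys. j < length ys) (tab_rows t)) = row_len (flip_tab t) j" if "j < row_len t 0" for j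
  proof -
    have "length (filter (\<lambda>ys. j < length ys) (tab_rows t)) = card {i. i < ?c \<and> j < row_len t i}"
      by (simp add: tab_rows_def length_filter_conv_card cong: conj_cong)
    also have "{i. i < ?c \<and> j < row_len t i} = {..<row_len (flip_tab t) j}"
    proof (intro set_eqI)
      fix i
      have "j < row_len t i \<longleftrightarrow> i < row_len (flip_tab t) j" "i < ?c \<longleftrightarrow> t i 0 \<noteq> 0"
        using nz_iff_row_len[OF assms, of i j] nz_col[OF assms, of i j] nz_col[OF assms, of i 0] by auto
      moreover have "t i j \<noteq> 0 \<Longrightarrow> t i 0 \<noteq> 0" using strict_tab_le(1)[OF assms(1), of i j i 0] by simp
      ultimately show "i \<in> {i. i < ?c \<and> j < row_len t i} \<longleftrightarrow> i \<in> {..<row_len (flip_tab t) j}"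
        using nz_col[OF assms, of i j] by auto
    qed
    finally show ?thesis by simp
  qed
  have sub: "i < ?c" if "i < row_len (flip_tab t) j" for i j
    using row_len_antimono[of "flip_tab t" n 0 j] assms that by auto
  show ?thesis
  proof (rule nth_equalityI)
    fix j assume "j < length (List.transpose (tab_rows t))"
    then have j: "j < row_len t 0" "j < length (List.transpose (tab_rows t))" using len by auto
    have "List.transpose (tab_rows t) ! j = map (\<lambda>i. t i j) [0..<row_len (flip_tab t) j]"
    proof (rule nth_equalityI)
      show 1: "length (List.transpose (tab_rows t) ! j) = length (map (\<lambda>i. t i j) [0..<row_len (flip_tab t) j])"
        using nth_transpose[OF j(2)] col[OF j(1)] by simp
      fix i assume "i < length (List.transpose (tab_rows t) ! j)"
      then have i: "i < row_len (flip_tab t) j" using 1 by simp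
      have "List.transpose (tab_rows t) ! j ! i = tab_rows t ! i ! j"
        using nth_nth_transpose_sorted[OF sorted j(2), of i] i col[OF j(1)] by simp
      also have "\<dots> = t i j"
        using i sub[OF i] nz_col[OF assms, of i j] nz_iff_row_len[OF assms, of i j] by (simp add: tab_rows_def)
      finally show "List.transpose (tab_rows t) ! j ! i = map (\<lambda>i. t i j) [0..<row_len (flip_tab t) j] ! i"
        using i by simp
    qed
    then show "List.transpose (tab_rows t) ! j = map (\<lambda>j. map (\<lambda>i. t i j) [0..<row_len (flip_tab t) j]) [0..<row_len t 0] ! j"
      using j by simp
  qed (simp add: len)
qed

lemma filter_upt_initial: "k \<le> n \<Longrightarrow> (\<And>i. f i \<noteq> 0 \<longleftrightarrow> i < k) \<Longrightarrow>
    filter (\<lambda>x. x \<noteq> (0::nat)) (map f [0..<n]) = map f [0..<k]"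
proof (induction n)
  case (Suc n)
  show ?case
  proof (cases "k = Suc n")
    case True
    then have "filter (\<lambda>x. x \<noteq> 0) (map f [0..<Suc n]) = map f [0..<Suc n]"
      using Suc.prems(2) by (auto simp: filter_id_conv simp del: upt_Suc)
    then show ?thesis using True by simp
  next
    case False
    then have "f n = 0" "k \<le> n" using Suc.prems(2)[of n] Suc.prems(1) by auto
    then show ?thesis using Suc.IH Suc.prems(2) by simp
  qed
qed simp

lemma row_len_le: "strict_tab t \<Longrightarrow> entries_below n t \<Longrightarrow> row_len t i \<le> n"
  using card_mono[OF _ row_support[of t n i]] by (simp add: row_len_def)

lemma filter_concat_map: "filter P (concat (map f xs)) = concat (map (\<lambda>x. filter P (f x)) xs)"
  by (induction xs) auto

lemma column_word_tab_rows:
  assumes "strict_tab t" "entries_below n t"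
  shows "column_word (tab_rows t) = filter (\<lambda>x. x \<noteq> 0) (col_word t n n)"
proof -
  let ?cw = "\<lambda>j. rev (map (\<lambda>i. t i j) [0..<row_len (flip_tab t) j])"
  have 1: "filter (\<lambda>x. x \<noteq> 0) (map (\<lambda>i. t i j) (rev [0..<n])) = ?cw j" for j
  proof -
    have "filter (\<lambda>x. x \<noteq> 0) (map (\<lambda>i. t i j) [0..<n]) = map (\<lambda>i. t i j) [0..<row_len (flip_tab t) j]"
      using row_len_le[of "flip_tab t" n j] nz_col[OF assms] assms by (intro filter_upt_initial) auto
    then show ?thesis by (simp add: rev_map[symmetric] rev_filter[symmetric])
  qed
  have "concat (map ?cw [0..<n]) = concat (map ?cw [0..<row_len t 0])"
  proof -
    have "?cw j = []" if "row_len t 0 \<le> j" for j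
      using that nz_iff_row_len[OF assms, of 0 j] nz_col[OF assms, of 0 j] by simp
    then have "concat (map ?cw [row_len t 0..<n]) = []" by auto
    moreover have "[0..<n] = [0..<row_len t 0] @ [row_len t 0..<n]"
      using row_len_le[OF assms, of 0] upt_add_eq_append[of 0 "row_len t 0" "n - row_len t 0"] by simp
    ultimately show ?thesis by simp
  qed
  then show ?thesis
    unfolding column_word_def transpose_tab_rows[OF assms] col_word_def filter_concat_map 1
    by (simp add: comp_def)
qed

lemma semistandard_tab_rows:
  assumes "strict_tab t" "entries_below n t" shows "semistandard (tab_rows t)"
  unfolding semistandard_def
proof (intro conjI)
  have 0: "row_len t i \<noteq> 0" if "i < row_len (flip_tab t) 0" for i
    using that nz_iff_row_len[OF assms, of i 0] nz_col[OF assms, of i 0] by auto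
  then show "[] \<notin> set (tab_rows t)" by (fastforce simp: tab_rows_def)
  show "sorted_wrt (\<ge>) (map length (tab_rows t))"
    by (auto simp: tab_rows_def sorted_wrt_iff_nth_less intro!: row_len_antimono[OF assms])
  have "t i j \<le> t i j'" if "j \<le> j'" "j' < row_len t i" for i j j'
    using that strict_tab_le(2)[OF assms(1), of i j' i j] nz_iff_row_len[OF assms, of i j'] by simp
  moreover have "1 \<le> t i j" if "j < row_len t i" for i j
    using that nz_iff_row_len[OF assms, of i j] by simp
  ultimately show "\<forall>r\<in>set (tab_rows t). sorted r \<and> (\<forall>x\<in>set r. 1 \<le> x)"
    by (auto simp: tab_rows_def sorted_iff_nth_mono)
  have "t i j < t i' j" if "i < i'" "i' < row_len (flip_tab t) j" for i i' j
    using that strict_tab_le(2)[OF assms(1), of i' j i j] nz_col[OF assms, of i' j] by simp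
  then show "\<forall>c\<in>set (List.transpose (tab_rows t)). sorted_wrt (<) c"
    by (auto simp: transpose_tab_rows[OF assms] sorted_wrt_iff_nth_less)
qed

lemma tab_rows_inj:
  assumes "strict_tab t" "entries_below n t" "strict_tab s" "entries_below n s" "tab_rows t = tab_rows s" shows "t = s"
proof (intro ext)
  fix i j
  have l: "row_len (flip_tab t) 0 = row_len (flip_tab s) 0" using arg_cong[OF assms(5), of length] by (simp add: tab_rows_def)
  have r: "map (t i) [0..<row_len t i] = map (s i) [0..<row_len s i]" if "i < row_len (flip_tab t) 0"
    using arg_cong[OF assms(5), of "\<lambda>x. x ! i"] that l by (simp add: tab_rows_def)
  have z: "t i j = 0" if "\<not> i < row_len (flip_tab t) 0" "strict_tab t" "entries_below n t" for t
    using that nz_col[OF that(2,3), of i 0] strict_tab_le(1)[OF that(2), of i j i 0] by (cases "t i j = 0") auto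
  show "t i j = s i j"
  proof (cases "i < row_len (flip_tab t) 0")
    case True
    have e: "row_len t i = row_len s i" using arg_cong[OF r[OF True], of length] by simp
    show ?thesis
    proof (cases "j < row_len t i")
      case j: True
      then show ?thesis using arg_cong[OF r[OF True], of "\<lambda>x. x ! j"] e by simp
    next
      case False
      then show ?thesis using e nz_iff_row_len[OF assms(1,2), of i j] nz_iff_row_len[OF assms(3,4), of i j] by simp
    qed
  next
    case False
    then show ?thesis using z[OF _ assms(1,2)] z[OF _ assms(3,4)] l by simp
  qed
qed

lemma mset_row_word_Suc: "mset (row_word t a (Suc b)) = mset (row_word t a b) + mset (map (\<lambda>i. t i b) (rev [0..<a]))"
  by (induction a) (auto simp: row_word_Suc)

lemma mset_row_word_col_word: "mset (row_word t a b) = mset (col_word t a b)"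
  by (induction b) (simp_all add: mset_row_word_Suc col_word_Suc)

lemma length_row_word:
  assumes "strict_tab t" "entries_below n t" shows "length (filter (\<lambda>x. x \<noteq> 0) (row_word t a n)) = (\<Sum>i<a. row_len t i)"
proof (induction a)
  case (Suc a)
  have "filter (\<lambda>x. x \<noteq> 0) (map (t a) [0..<n]) = map (t a) [0..<row_len t a]"
    using row_len_le[OF assms, of a] nz_iff_row_len[OF assms] by (intro filter_upt_initial) auto
  then show ?case using Suc by (simp add: row_word_Suc)
qed simp

text \<open>Insertion works with row readings, the tableaux of the theorem with column readings.
  Both have the same product and the same letters, and the common length \<open>inv_count w\<close>
  is a lower bound for every word of \<open>w\<close>.\<close>

lemma tab_rows_in_EG:
  assumes "t \<in> red_tabs n w" shows "tab_rows t \<in> EG_tableaux n w"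
proof -
  have t: "strict_tab t" "entries_below n t" "word_prod (row_word t n n) = w" "(\<Sum>i<n. row_len t i) = inv_count w"
    using assms by (auto simp: red_tabs_def)
  let ?c = "filter (\<lambda>x. x \<noteq> 0) (col_word t n n)"
  have "word_perm ?c = w" unfolding word_perm_filter using t(3) word_prod_row_word_col_word[OF t(1), of n n] by simp
  moreover have "set ?c \<subseteq> {1..<n}"
    using entries_belowD[OF t(2)] by (auto simp: col_word_def)
  ultimately have 1: "?c \<in> words_of n w" by (simp add: words_of_def)
  have "mset ?c = mset (filter (\<lambda>x. x \<noteq> 0) (row_word t n n))"
    by (simp only: mset_filter mset_row_word_col_word)
  then have "length ?c = inv_count w"
    using length_row_word[OF t(1,2), of n] t(4) by (metis size_mset)
  moreover have "inv_count w \<le> length b" if "b \<in> words_of n w" for b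
  proof -
    have "0 \<notin> set b" "word_perm b = w" using that by (auto simp: words_of_def)
    moreover from this(1) have "filter (\<lambda>x. x \<noteq> 0) b = b" by (intro filter_True ballI notI) simp
    ultimately show ?thesis using inv_count_word_prod[of b] word_perm_filter[of b] by simp
  qed
  ultimately have "?c \<in> reduced_words n w" using 1 by (auto simp: reduced_words_def)
  then show ?thesis
    using semistandard_tab_rows[OF t(1,2)] column_word_tab_rows[OF t(1,2)] by (simp add: EG_tableaux_def)
qed

lemma red_tabs_EG: "finite (red_tabs n w)" "card (red_tabs n w) \<le> EG n w"
proof -
  have inj: "inj_on tab_rows (red_tabs n w)"
    using tab_rows_inj by (intro inj_onI) (simp add: red_tabs_def, blast)
  have sub: "tab_rows ` red_tabs n w \<subseteq> EG_tableaux n w" using tab_rows_in_EG by blast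
  show "finite (red_tabs n w)" using inj sub finite_EG_tableaux finite_subset finite_imageD by metis
  show "card (red_tabs n w) \<le> EG n w"
    unfolding EG_def using inj sub finite_EG_tableaux by (rule card_inj_on_le)
qed

section \<open>Deleting the maximal value\<close>

lemma cycle_to_less: "x \<noteq> p \<Longrightarrow> y \<noteq> p \<Longrightarrow> cycle_to p n x < cycle_to p n y \<longleftrightarrow> x < y"
  by (auto simp: cycle_to_def)

lemma inv_apply: "w permutes S \<Longrightarrow> w (inv w x) = x" "w permutes S \<Longrightarrow> inv w (w x) = x"
  by (simp_all add: permutes_inverses)

text \<open>Deleting \<open>n\<close> closes one gap among the positions and preserves the relative
  order of all other values. The last clause is the form in which codes and patterns pass between
  \<open>w\<close> and \<open>v\<close>.\<close>

lemma del_max: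
  assumes w: "w permutes {1..n}" and n: "0 < n"
  shows "\<exists>v. v permutes {1..n - 1} \<and> w = v \<circ> cycle_to (inv w n) n \<and> 0 < inv w n \<and> inv w n \<le> n \<and>
    (\<forall>b. inv v b = cycle_to (inv w n) n (inv w b)) \<and>
    (\<forall>a b. a \<noteq> n \<longrightarrow> b \<noteq> n \<longrightarrow> inv v a < inv v b \<longleftrightarrow> inv w a < inv w b)"
proof -
  let ?p = "inv w n"
  let ?v = "w \<circ> inv (cycle_to ?p n)"
  have p: "0 < ?p" "?p \<le> n" using permutes_in[OF permutes_inv[OF w], of n] n by auto
  note c = permutes_cycle_to[OF p]
  have vn: "?v permutes {1..n}" using w permutes_inv[OF c] by (rule permutes_compose[rotated])
  have "?v n = n"
  proof -
    have "cycle_to ?p n ?p = n" by (simp add: cycle_to_def)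
    then have "inv (cycle_to ?p n) n = ?p" using inv_apply(2)[OF c, of ?p] by simp
    then show ?thesis using inv_apply(1)[OF w, of n] by simp
  qed
  then have v: "?v permutes {1..n - 1}"
    by (intro permutes_superset[OF vn]) (metis Diff_iff One_nat_def Suc_pred atLeastAtMost_iff le_SucE n)
  have e: "w = ?v \<circ> cycle_to ?p n" using inv_apply(2)[OF c] by (auto simp: fun_eq_iff)
  have i: "inv ?v b = cycle_to ?p n (inv w b)" for b
    using inv_apply(2)[OF v, of "cycle_to ?p n (inv w b)"] fun_cong[OF e, of "inv w b"] inv_apply(1)[OF w, of b]
    by simp
  have ne: "inv w a \<noteq> ?p" if "a \<noteq> n" for a
    using that inv_apply(1)[OF w, of a] inv_apply(1)[OF w, of n] by metis
  have "\<forall>a b. a \<noteq> n \<longrightarrow> b \<noteq> n \<longrightarrow> inv ?v a < inv ?v b \<longleftrightarrow> inv w a < inv w b"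
    unfolding i using cycle_to_less[OF ne ne] by blast
  then show ?thesis using v e p i by blast
qed

text \<open>This is the Lehmer code of \<open>inv w\<close>: it counts the larger values to the left
  of \<open>b\<close>.\<close>

definition code :: "(nat \<Rightarrow> nat) \<Rightarrow> nat \<Rightarrow> nat" where
  "code w b = card {z. b < z \<and> inv w z < inv w b}"

definition code_below :: "(nat \<Rightarrow> nat) \<Rightarrow> nat \<Rightarrow> nat \<Rightarrow> nat" where
  "code_below w N b = card {z. b < z \<and> z < N \<and> inv w z < inv w b}"

text \<open>
  For \<open>N\<close> as below, the values to the right of \<open>N\<close> do not carry the largest entries of the code of the
  restriction of \<open>w\<close> to values below \<open>N\<close>.
\<close>

definition strict_value :: "(nat \<Rightarrow> nat) \<Rightarrow> nat \<Rightarrow> bool" where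
  "strict_value w N \<longleftrightarrow> (\<exists>b' b. 0 < b' \<and> b' < b \<and> b < N \<and> inv w b' < inv w N \<and> inv w N < inv w b \<and> code_below w N b < code_below w N b')"

definition strict_values :: "nat \<Rightarrow> (nat \<Rightarrow> nat) \<Rightarrow> nat set" where
  "strict_values n w = {N \<in> {1..n}. strict_value w N}"

definition cells_above :: "(nat \<Rightarrow> nat \<Rightarrow> nat) \<Rightarrow> nat \<Rightarrow> nat" where
  "cells_above t r = (\<Sum>i<r. row_len t i)"

text \<open>Dominance of the shape over the decreasingly sorted code. Ranging over all sets of
  values replaces the sorting.\<close>

definition dominates_code :: "nat \<Rightarrow> (nat \<Rightarrow> nat \<Rightarrow> nat) \<Rightarrow> (nat \<Rightarrow> nat) \<Rightarrow> bool" where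
  "dominates_code n t w \<longleftrightarrow> (\<forall>X \<subseteq> {1..n}. (\<Sum>b\<in>X. code w b) \<le> cells_above t (card X))"

lemma cells_above_mono: "r \<le> s \<Longrightarrow> cells_above t r \<le> cells_above t s"
  unfolding cells_above_def by (rule sum_mono2) auto

lemma code_below_transfer:
  assumes "\<forall>a b. a \<noteq> n \<longrightarrow> b \<noteq> n \<longrightarrow> inv v a < inv v b \<longleftrightarrow> inv w a < inv w b" "N \<le> n" "b < N"
  shows "code_below v N b = code_below w N b"
proof -
  have "{z. b < z \<and> z < N \<and> inv v z < inv v b} = {z. b < z \<and> z < N \<and> inv w z < inv w b}"
  proof (rule Collect_cong)
    fix z show "(b < z \<and> z < N \<and> inv v z < inv v b) = (b < z \<and> z < N \<and> inv w z < inv w b)"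
      using assms(1)[rule_format, of z b] assms(2,3) by auto
  qed
  then show ?thesis by (simp add: code_below_def)
qed

lemma strict_value_transfer:
  assumes "\<forall>a b. a \<noteq> n \<longrightarrow> b \<noteq> n \<longrightarrow> inv v a < inv v b \<longleftrightarrow> inv w a < inv w b" "N < n"
  shows "strict_value v N \<longleftrightarrow> strict_value w N"
proof -
  have "(0 < b' \<and> b' < b \<and> b < N \<and> inv v b' < inv v N \<and> inv v N < inv v b \<and> code_below v N b < code_below v N b') =
    (0 < b' \<and> b' < b \<and> b < N \<and> inv w b' < inv w N \<and> inv w N < inv w b \<and> code_below w N b < code_below w N b')" for b b'
    using assms(1)[rule_format, of b' N] assms(1)[rule_format, of N b] assms(2)
      code_below_transfer[OF assms(1), of N b] code_below_transfer[OF assms(1), of N b'] by auto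
  then show ?thesis unfolding strict_value_def by simp
qed

lemma code_del:
  assumes w: "w permutes {1..n}" and v: "v permutes {1..n - 1}"
    and o: "\<forall>a b. a \<noteq> n \<longrightarrow> b \<noteq> n \<longrightarrow> inv v a < inv v b \<longleftrightarrow> inv w a < inv w b"
    and b: "0 < b" "b < n"
  shows "code v b = code_below w n b" "code w b = code_below w n b + (if inv w n < inv w b then 1 else 0)"
proof -
  have fin: "finite {z. b < z \<and> z < n \<and> inv w z < inv w b}" by (rule finite_subset[of _ "{..n}"]) auto
  have vz: "inv v z = z" if "n \<le> z" for z using permutes_out(1)[OF permutes_inv[OF v], of z] b that by auto
  have "b \<le> n - 1" using b by linarith
  then have vb: "inv v b < n" using permutes_le[OF permutes_inv[OF v], of b] b by linarith
  have "{z. b < z \<and> inv v z < inv v b} = {z. b < z \<and> z < n \<and> inv w z < inv w b}"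
  proof (rule Collect_cong)
    fix z show "(b < z \<and> inv v z < inv v b) = (b < z \<and> z < n \<and> inv w z < inv w b)"
      using o[rule_format, of z b] b vz[of z] vb by (cases "z < n") auto
  qed
  then show "code v b = code_below w n b" by (simp add: code_def code_below_def)
  have wz: "inv w z = z" if "n < z" for z using permutes_out(1)[OF permutes_inv[OF w], of z] that by auto
  have wb: "inv w b \<le> n" using permutes_le[OF permutes_inv[OF w], of b] b by auto
  have "{z. b < z \<and> inv w z < inv w b} = {z. b < z \<and> z < n \<and> inv w z < inv w b} \<union> (if inv w n < inv w b then {n} else {})"
  proof (intro set_eqI)
    fix z show "z \<in> {z. b < z \<and> inv w z < inv w b} \<longleftrightarrow>
        z \<in> {z. b < z \<and> z < n \<and> inv w z < inv w b} \<union> (if inv w n < inv w b then {n} else {})"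
      using b wz[of z] wb by (cases "z < n"; cases "z = n") auto
  qed
  then show "code w b = code_below w n b + (if inv w n < inv w b then 1 else 0)"
    using fin by (simp add: code_def code_below_def)
qed

lemma code_max:
  assumes w: "w permutes {1..n}" shows "code w n = 0"
proof -
  have "inv w n \<le> n" using permutes_le[OF permutes_inv[OF w], of n] by simp
  moreover have "inv w z = z" if "n < z" for z using permutes_out(1)[OF permutes_inv[OF w], of z] that by auto
  ultimately have "{z. n < z \<and> inv w z < inv w n} = {}" by force
  then show ?thesis unfolding code_def by (simp only: card.empty)
qed

lemma cells_above_insert_max:
  assumes "strict_tab t" "entries_below m t" "0 < p"
  shows "cells_above (insert_max p n t) r = cells_above t r + min r (n - p)"
proof -
  have "{..<r} \<inter> {i. p + i < n} = {..<min r (n - p)}" by auto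
  then have "(\<Sum>i<r. if p + i < n then 1 else (0::nat)) = min r (n - p)"
    by (simp add: sum.If_cases)
  then show ?thesis unfolding cells_above_def row_len_insert_max[OF assms] sum.distrib by simp
qed

lemma card_right_of:
  assumes w: "w permutes {1..n}"
  shows "card {b \<in> {1..n}. p < inv w b} \<le> n - p"
proof -
  have "inv w ` {b \<in> {1..n}. p < inv w b} \<subseteq> {p<..n}"
  proof (rule image_subsetI)
    fix b assume "b \<in> {b \<in> {1..n}. p < inv w b}"
    then show "inv w b \<in> {p<..n}" using permutes_le[OF permutes_inv[OF w], of b] by simp
  qed
  moreover have "inj_on (inv w) {b \<in> {1..n}. p < inv w b}"
    using inj_on_subset[OF permutes_inj[OF permutes_inv[OF w]] subset_UNIV] .
  ultimately show ?thesis using card_inj_on_le[of "inv w" _ "{p<..n}"] by simp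
qed

lemma sum_code_del:
  assumes w: "w permutes {1..n}" and v: "v permutes {1..n - 1}"
    and o: "\<forall>a b. a \<noteq> n \<longrightarrow> b \<noteq> n \<longrightarrow> inv v a < inv v b \<longleftrightarrow> inv w a < inv w b"
    and X: "X \<subseteq> {1..n}"
  shows "(\<Sum>b\<in>X. code w b) = (\<Sum>b\<in>X - {n}. code v b) + card {b \<in> X. inv w n < inv w b}"
proof -
  have fin: "finite X" using X finite_subset by auto
  have "(\<Sum>b\<in>X. code w b) = (\<Sum>b\<in>X - {n}. code w b)"
    using code_max[OF w] fin by (intro sum.mono_neutral_right) auto
  also have "\<dots> = (\<Sum>b\<in>X - {n}. code v b + (if inv w n < inv w b then 1 else 0))"
  proof (rule sum.cong)
    fix b assume "b \<in> X - {n}"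
    then have "0 < b" "b < n" using X by force+
    then show "code w b = code v b + (if inv w n < inv w b then 1 else 0)"
      using code_del[OF w v o, of b] by simp
  qed simp
  also have "\<dots> = (\<Sum>b\<in>X - {n}. code v b) + card ((X - {n}) \<inter> {b. inv w n < inv w b})"
    unfolding sum.distrib using fin by (simp add: sum.If_cases)
  also have "(X - {n}) \<inter> {b. inv w n < inv w b} = {b \<in> X. inv w n < inv w b}" by auto
  finally show ?thesis .
qed

text \<open>Passing from \<open>v\<close> to \<open>w\<close> raises by one exactly the codes of the
  values right of \<open>n\<close>. A set \<open>X\<close> contains at most \<open>card X\<close> of
  them and at most \<open>n - p\<close>, with \<open>p\<close> the position of \<open>n\<close>,
  while the first \<open>card X\<close> rows gain the minimum of these two numbers.\<close>

lemma dominates_code_insert_max: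
  assumes w: "w permutes {1..n}" and v: "v permutes {1..n - 1}"
    and o: "\<forall>a b. a \<noteq> n \<longrightarrow> b \<noteq> n \<longrightarrow> inv v a < inv v b \<longleftrightarrow> inv w a < inv w b"
    and t: "strict_tab t" "entries_below (n - 1) t" "dominates_code (n - 1) t v" and p: "0 < inv w n"
  shows "dominates_code n (insert_max (inv w n) n t) w"
  unfolding dominates_code_def
proof (intro allI impI)
  fix X assume X: "X \<subseteq> {1..n}"
  have fin: "finite X" using X finite_subset by auto
  have "card {b \<in> X. inv w n < inv w b} \<le> card {b \<in> {1..n}. inv w n < inv w b}"
    using X by (intro card_mono) auto
  then have 1: "card {b \<in> X. inv w n < inv w b} \<le> n - inv w n" using card_right_of[OF w, of "inv w n"] by linarith
  have 2: "card {b \<in> X. inv w n < inv w b} \<le> card X" using fin by (intro card_mono) auto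
  have "X - {n} \<subseteq> {1..n - 1}" using X by force
  then have "(\<Sum>b\<in>X - {n}. code v b) \<le> cells_above t (card (X - {n}))" using t(3) unfolding dominates_code_def by blast
  also have "\<dots> \<le> cells_above t (card X)" using fin by (intro cells_above_mono card_mono) auto
  finally show "(\<Sum>b\<in>X. code w b) \<le> cells_above (insert_max (inv w n) n t) (card X)"
    unfolding sum_code_del[OF w v o X] cells_above_insert_max[OF t(1,2) p] using 1 2 by simp
qed

section \<open>Tableaux of distinct shapes\<close>

text \<open>The inequality opposite to \<open>dominates_code\<close>; together they say that the row
  lengths are the sorted code. The bound \<open>card X \<le> r\<close>, instead of equality, allows
  \<open>r\<close> beyond \<open>n\<close>.\<close>

definition attains_code :: "nat \<Rightarrow> (nat \<Rightarrow> nat \<Rightarrow> nat) \<Rightarrow> (nat \<Rightarrow> nat) \<Rightarrow> bool" where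
  "attains_code n t w \<longleftrightarrow> (\<forall>r. \<exists>X \<subseteq> {1..n}. card X \<le> r \<and> cells_above t r \<le> (\<Sum>b\<in>X. code w b))"

text \<open>With \<open>w = inv u\<close>, the value at the last position of \<open>w\<close> is
  \<open>m\<close>. All \<open>n - m\<close> larger values stand to its left, and its removal only
  relabels the other values, because it is to the left of none of them.\<close>

lemma code_del_last:
  assumes u: "u permutes {1..n}" and v: "v permutes {1..n - 1}" and n: "0 < n"
    and e: "u = v \<circ> cycle_to m n" and m: "0 < m" "m \<le> n"
  shows "b \<noteq> m \<Longrightarrow> b \<le> n \<Longrightarrow> code (inv u) b = code (inv v) (cycle_to m n b)" "code (inv u) m = n - m"
proof -
  have iu: "inv (inv u) = u" "inv (inv v) = v" using permutes_inv_inv[OF u] permutes_inv_inv[OF v] .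
  note c = permutes_cycle_to[OF m]
  have vn: "v n = n" using permutes_out(1)[OF v, of n] n by simp
  have um: "u m = n" using vn by (simp add: e cycle_to_def)
  have un: "u a \<noteq> n" if "a \<noteq> m" for a using that um permutes_inj[OF u] by (metis injD)
  show "code (inv u) b = code (inv v) (cycle_to m n b)" if b: "b \<noteq> m" "b \<le> n"
  proof -
    have ub: "u b < n" using permutes_le[OF u b(2)] un[OF b(1)] by linarith
    have "cycle_to m n ` {z. b < z \<and> u z < u b} = {z. cycle_to m n b < z \<and> v z < v (cycle_to m n b)}"
    proof (intro set_eqI iffI)
      fix y assume "y \<in> cycle_to m n ` {z. b < z \<and> u z < u b}"
      then obtain z where z: "y = cycle_to m n z" "b < z" "u z < u b" by blast
      then have "z \<noteq> m" using um ub by auto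
      then show "y \<in> {z. cycle_to m n b < z \<and> v z < v (cycle_to m n b)}"
        using z cycle_to_less[OF b(1), of z n] by (simp add: e)
    next
      fix y assume y: "y \<in> {z. cycle_to m n b < z \<and> v z < v (cycle_to m n b)}"
      define z where "z = inv (cycle_to m n) y"
      have yz: "y = cycle_to m n z" using inv_apply(1)[OF c, of y] by (simp add: z_def)
      have uz: "u z < u b" using y yz by (simp add: e)
      then have "z \<noteq> m" using um ub by auto
      then have "b < z" using y yz cycle_to_less[OF b(1), of z n] by simp
      then show "y \<in> cycle_to m n ` {z. b < z \<and> u z < u b}" using yz uz by blast
    qed
    moreover have "card (cycle_to m n ` {z. b < z \<and> u z < u b}) = card {z. b < z \<and> u z < u b}"
      by (intro card_image inj_on_subset[OF permutes_inj[OF c] subset_UNIV])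
    ultimately show ?thesis by (simp add: code_def iu)
  qed
  have "{z. m < z \<and> u z < u m} = {m<..n}"
  proof (intro set_eqI iffI)
    fix z assume "z \<in> {z. m < z \<and> u z < u m}"
    then have z: "m < z" "u z < n" using um by auto
    have "z \<le> n"
    proof (rule ccontr)
      assume "\<not> z \<le> n"
      then show False using permutes_out(1)[OF u, of z] z by simp
    qed
    then show "z \<in> {m<..n}" using z by simp
  next
    fix z assume z: "z \<in> {m<..n}"
    then have "u z \<le> n" "u z \<noteq> n" using permutes_le[OF u, of z] un[of z] by auto
    then show "z \<in> {z. m < z \<and> u z < u m}" using z um by simp
  qed
  then show "code (inv u) m = n - m" by (simp add: code_def iu)
qed

text \<open>Adding a cell to each of the first \<open>n - m\<close> columns amounts to inserting a
  part \<open>n - m\<close> into the decreasing list of row lengths. The first \<open>Suc r\<close>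
  parts then consist of \<open>r\<close> old ones and the larger of the new part and old row
  \<open>r\<close>.\<close>

lemma cells_above_insert_last:
  assumes t: "strict_tab t" "entries_below k t" and m: "0 < m"
  shows "cells_above (flip_tab (insert_max m n (flip_tab t))) (Suc r) = cells_above t r + max (n - m) (row_len t r)"
proof -
  let ?t = "flip_tab (insert_max m n (flip_tab t))"
  let ?L = "n - m"
  have nz: "?t i j \<noteq> 0 \<longleftrightarrow> (if j < ?L then i = 0 \<or> j < row_len t (i - 1) else j < row_len t i)" for i j
  proof -
    have "insert_max m n (flip_tab t) j i \<noteq> 0 \<longleftrightarrow> (if j < ?L then i = 0 \<or> flip_tab t j (i - 1) \<noteq> 0 else flip_tab t j i \<noteq> 0)"
      using insert_row_neq_0[of "flip_tab t j" "m + j" i] strict_tab_strict_row[of "flip_tab t" j] t(1) m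
      by (auto simp: insert_max_def)
    then show ?thesis
      using nz_iff_row_len[OF t, of "i - 1" j] nz_iff_row_len[OF t, of i j] by (simp add: flip_tab_def)
  qed
  have r0: "row_len ?t 0 = max ?L (row_len t 0)"
  proof -
    have e: "{j. ?t 0 j \<noteq> 0} = {..<max ?L (row_len t 0)}" unfolding nz by auto
    show ?thesis unfolding row_len_def[of ?t 0] e by simp
  qed
  have rS: "row_len ?t (Suc i) = min ?L (row_len t i) + (row_len t (Suc i) - ?L)" for i
  proof -
    have "{j. ?t (Suc i) j \<noteq> 0} = {..<min ?L (row_len t i)} \<union> {?L..<row_len t (Suc i)}" unfolding nz by auto
    moreover have "card ({..<min ?L (row_len t i)} \<union> {?L..<row_len t (Suc i)}) = min ?L (row_len t i) + (row_len t (Suc i) - ?L)"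
      by (subst card_Un_disjoint) auto
    ultimately show ?thesis by (simp add: row_len_def[of ?t])
  qed
  have ar: "max L x + (min L x + (y - L)) = x + max L y" for L x y :: nat
    by (simp add: max_def min_def)
  show ?thesis
  proof (induction r)
    case 0
    then show ?case by (simp add: cells_above_def r0)
  next
    case (Suc r)
    have "cells_above ?t (Suc (Suc r)) = cells_above ?t (Suc r) + row_len ?t (Suc r)" by (simp add: cells_above_def)
    also have "\<dots> = cells_above t r + max ?L (row_len t r) + (min ?L (row_len t r) + (row_len t (Suc r) - ?L))"
      unfolding Suc rS ..
    also have "\<dots> = cells_above t (Suc r) + max ?L (row_len t (Suc r))"
      by (simp only: cells_above_def sum.lessThan_Suc add.assoc ar)
    finally show ?case .
  qed
qed

text \<open>
  Deleting last positions only gives a tableau whose row lengths are the sorted code.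
\<close>

lemma minimal_tableau:
  "w permutes {1..n} \<Longrightarrow> \<exists>t \<in> red_tabs n w. dominates_code n t w \<and> attains_code n t w"
proof (induction n arbitrary: w)
  case 0
  then have w: "w = id" by simp
  let ?t = "\<lambda>i j. 0 :: nat"
  have i: "inversions id = {}" by (auto simp: inversions_def)
  have "?t \<in> red_tabs 0 w" unfolding red_tabs_def w
    using i by (simp add: strict_tab_def entries_below_def id_def)
  moreover have "dominates_code 0 ?t w" by (simp add: dominates_code_def)
  moreover have "attains_code 0 ?t w" by (simp add: attains_code_def cells_above_def row_len_def)
  ultimately show ?case by blast
next
  case (Suc k)
  let ?n = "Suc k" and ?m = "w (Suc k)"
  let ?u = "inv w"
  have iw: "inv ?u = w" using permutes_inv_inv[OF Suc.prems] .
  have u: "?u permutes {1..?n}" using permutes_inv[OF Suc.prems] .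
  obtain v where v: "v permutes {1..k}" "?u = v \<circ> cycle_to ?m ?n" "0 < ?m" "?m \<le> ?n"
    using del_max[OF u] unfolding iw by auto
  have v': "v permutes {1..?n - 1}" using v(1) by simp
  note cc1 = code_del_last(1)[OF u v' _ v(2-4), unfolded iw]
  note cc2 = code_del_last(2)[OF u v' _ v(2-4), unfolded iw]
  obtain t where t: "t \<in> red_tabs k (inv v)" "dominates_code k t (inv v)" "attains_code k t (inv v)"
    using Suc.IH[OF permutes_inv[OF v(1)]] by blast
  have ts: "strict_tab t" "entries_below k t" using t(1) unfolding red_tabs_def by blast+
  define t' where "t' = flip_tab (insert_max ?m ?n (flip_tab t))"
  have "flip_tab t \<in> red_tabs k v"
    using red_tabs_flip_tab[OF permutes_inv[OF v(1)] t(1)] permutes_inv_inv[OF v(1)] by simp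
  then have "insert_max ?m ?n (flip_tab t) \<in> red_tabs ?n ?u"
    using red_tabs_insert_max[of v ?n "flip_tab t" ?m] v by simp
  then have t'G: "t' \<in> red_tabs ?n w" using red_tabs_flip_tab[OF u] iw by (simp add: t'_def)
  have St': "cells_above t' (Suc r) = cells_above t r + max (?n - ?m) (row_len t r)" for r
    unfolding t'_def by (rule cells_above_insert_last[OF ts v(3)])
  have S0: "cells_above t' 0 = 0" by (simp add: cells_above_def)
  have SS: "cells_above t (Suc r) = cells_above t r + row_len t r" for r by (simp add: cells_above_def)
  have le1: "cells_above t r \<le> cells_above t' r" for r by (cases r) (simp_all add: St' SS, simp add: cells_above_def)
  have le2: "cells_above t r + (?n - ?m) \<le> cells_above t' (Suc r)" for r by (simp add: St')
  let ?c = "cycle_to ?m ?n"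
  note c = permutes_cycle_to[OF v(3,4)]
  have injc: "inj_on ?c A" for A by (rule inj_on_subset[OF permutes_inj[OF c] subset_UNIV])
  have cm: "?c ?m = ?n" by (simp add: cycle_to_def)
  have sum1: "(\<Sum>b\<in>Y. code w b) = (\<Sum>b\<in>?c ` Y. code (inv v) b)" if "Y \<subseteq> {1..?n} - {?m}" for Y
    unfolding sum.reindex[OF injc] comp_def using that by (intro sum.cong) (auto intro!: cc1)
  have img: "?c ` Y \<subseteq> {1..k}" if "Y \<subseteq> {1..?n} - {?m}" for Y
  proof (rule image_subsetI)
    fix y assume "y \<in> Y"
    then have "0 < y" "y \<le> ?n" "y \<noteq> ?m" using that by auto
    then show "?c y \<in> {1..k}" using v(3,4) by (auto simp: cycle_to_def)
  qed
  have "dominates_code ?n t' w" unfolding dominates_code_def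
  proof (intro allI impI)
    fix X assume X: "X \<subseteq> {1..?n}"
    have fin: "finite X" using X finite_subset by auto
    let ?Y = "X - {?m}"
    have Y: "?Y \<subseteq> {1..?n} - {?m}" using X by auto
    have "(\<Sum>b\<in>?Y. code w b) \<le> cells_above t (card (?c ` ?Y))"
      unfolding sum1[OF Y] using t(2) img[OF Y] unfolding dominates_code_def by blast
    then have 1: "(\<Sum>b\<in>?Y. code w b) \<le> cells_above t (card ?Y)" by (simp add: card_image injc)
    show "(\<Sum>b\<in>X. code w b) \<le> cells_above t' (card X)"
    proof (cases "?m \<in> X")
      case True
      have "(\<Sum>b\<in>X. code w b) = (?n - ?m) + (\<Sum>b\<in>?Y. code w b)"
        using sum.remove[OF fin True, of "code w"] cc2 by simp
      moreover have "card X = Suc (card ?Y)" using card.remove[OF fin True] .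
      ultimately show ?thesis using 1 le2[of "card ?Y"] by simp
    next
      case False
      then show ?thesis using 1 le1[of "card X"] by simp
    qed
  qed
  moreover have "attains_code ?n t' w" unfolding attains_code_def
  proof (intro allI)
    fix r
    have pre: "\<exists>Y \<subseteq> {1..?n} - {?m}. card Y \<le> s \<and> cells_above t s \<le> (\<Sum>b\<in>Y. code w b)" for s
    proof -
      obtain X where X: "X \<subseteq> {1..k}" "card X \<le> s" "cells_above t s \<le> (\<Sum>b\<in>X. code (inv v) b)"
        using t(3) unfolding attains_code_def by blast
      let ?Y = "inv ?c ` X"
      have XY: "?c ` ?Y = X" using inv_apply(1)[OF c] by (force simp: image_iff)
      have Y: "?Y \<subseteq> {1..?n} - {?m}"
      proof
        fix y assume "y \<in> ?Y"
        then obtain x where x: "x \<in> X" "y = inv ?c x" by blast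
        then have cy: "?c y = x" "0 < x" "x \<le> k" using inv_apply(1)[OF c, of x] X(1) by auto
        moreover have "y \<in> {1..?n}" using cy permutes_in_image[OF c, of y] by auto
        ultimately show "y \<in> {1..?n} - {?m}" using cm by auto
      qed
      have "card ?Y \<le> s" using card_image_le[of X "inv ?c"] X finite_subset[OF X(1)] by force
      then show ?thesis using X(3) sum1[OF Y] XY Y by metis
    qed
    show "\<exists>X\<subseteq>{1..?n}. card X \<le> r \<and> cells_above t' r \<le> (\<Sum>b\<in>X. code w b)"
    proof (cases r)
      case 0
      then show ?thesis using S0 by (intro exI[of _ "{}"]) simp
    next
      case (Suc s)
      \<comment> \<open>The new part \<open>?n - ?m\<close> is the code of the value
        \<open>?m\<close>. If it is not larger than row \<open>s\<close>, the old rows already give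
        the sum; otherwise it counts among the first \<open>r\<close> parts and \<open>?m\<close>
        joins the set.\<close>
      show ?thesis
      proof (cases "?n - ?m \<le> row_len t s")
        case True
        then have "cells_above t' r = cells_above t r" by (simp add: Suc St' SS)
        then show ?thesis using pre[of r] by (metis Diff_subset order_trans)
      next
        case False
        obtain Y where Y: "Y \<subseteq> {1..?n} - {?m}" "card Y \<le> s" "cells_above t s \<le> (\<Sum>b\<in>Y. code w b)"
          using pre[of s] by blast
        have fin: "finite Y" and m: "?m \<notin> Y" using Y(1) finite_subset by auto
        have "cells_above t' r = cells_above t s + (?n - ?m)" using False by (simp add: Suc St')
        also have "\<dots> \<le> (\<Sum>b\<in>insert ?m Y. code w b)" using Y(3) fin m cc2 by simp
        finally have "cells_above t' r \<le> (\<Sum>b\<in>insert ?m Y. code w b)" .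
        moreover have "card (insert ?m Y) \<le> r" using Y(2) fin m by (simp add: Suc)
        moreover have "insert ?m Y \<subseteq> {1..?n}" using Y(1) v(3,4) by auto
        ultimately show ?thesis by blast
      qed
    qed
  qed
  ultimately show ?case using t'G by blast
qed

text \<open>Put \<open>K = n - p\<close> with \<open>p\<close> the position of \<open>n\<close>.
  Insertion adds \<open>K\<close> cells to the first \<open>K\<close> rows, so a set attaining their
  number must gain \<open>K\<close> as well and hence consists of all values right of
  \<open>n\<close>. It would then have maximal code sum in \<open>v\<close> among sets of that size,
  but exchanging \<open>b\<close> for \<open>b'\<close> raises the sum.\<close>

lemma strict_value_new:
  assumes w: "w permutes {1..n}" and v: "v permutes {1..n - 1}"
    and o: "\<forall>a b. a \<noteq> n \<longrightarrow> b \<noteq> n \<longrightarrow> inv v a < inv v b \<longleftrightarrow> inv w a < inv w b"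
    and t: "strict_tab t" "entries_below (n - 1) t" "dominates_code (n - 1) t v" and p: "0 < inv w n"
    and st: "strict_value w n" and up: "attains_code n t' w"
  shows "t' \<noteq> insert_max (inv w n) n t"
proof
  assume eq: "t' = insert_max (inv w n) n t"
  let ?p = "inv w n"
  let ?K = "n - ?p"
  obtain b' b where b: "0 < b'" "b' < b" "b < n" "inv w b' < ?p" "?p < inv w b" "code_below w n b < code_below w n b'"
    using st unfolding strict_value_def by blast
  obtain X where X: "X \<subseteq> {1..n}" "card X \<le> ?K" "cells_above t' ?K \<le> (\<Sum>b\<in>X. code w b)"
    using up unfolding attains_code_def by blast
  have fin: "finite X" using X(1) finite_subset by auto
  let ?B = "{b \<in> X. ?p < inv w b}"
  let ?R = "{b \<in> {1..n}. ?p < inv w b}"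
  have St: "cells_above t' ?K = cells_above t ?K + ?K" unfolding eq cells_above_insert_max[OF t(1,2) p] by simp
  have Xn: "X - {n} \<subseteq> {1..n - 1}" using X(1) by force
  have "(\<Sum>b\<in>X - {n}. code v b) \<le> cells_above t (card (X - {n}))" using t(3) Xn unfolding dominates_code_def by blast
  also have "\<dots> \<le> cells_above t ?K" using X(2) card_mono[OF fin, of "X - {n}"] by (intro cells_above_mono) auto
  finally have 1: "(\<Sum>b\<in>X - {n}. code v b) \<le> cells_above t ?K" .
  have 2: "cells_above t ?K + ?K \<le> (\<Sum>b\<in>X - {n}. code v b) + card ?B"
    using X(3) unfolding St sum_code_del[OF w v o X(1)] .
  have cB: "?K \<le> card ?B" using 1 2 by linarith
  have "?B = X" using cB X(2) fin by (intro card_seteq) auto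
  moreover have "?B = ?R"
  proof (rule card_seteq)
    show "card ?R \<le> card ?B" using card_right_of[OF w, of ?p] cB by linarith
  qed (use X(1) in auto)
  ultimately have XR: "X = ?R" by simp
  have nX: "n \<notin> X" unfolding XR by simp
  have bX: "b \<in> X" "b' \<notin> X" unfolding XR using b by auto
  have 3: "cells_above t ?K \<le> (\<Sum>b\<in>X. code v b)" using 2 X(2) card_mono[OF fin, of ?B] nX by auto
  let ?Y = "insert b' (X - {b})"
  have cY: "card ?Y = card X" using bX fin card.remove[OF fin bX(1)] by simp
  have "?Y \<subseteq> {1..n - 1}" using Xn nX b by auto
  then have 4: "(\<Sum>b\<in>?Y. code v b) \<le> cells_above t (card ?Y)" using t(3) unfolding dominates_code_def by blast
  have 5: "cells_above t (card ?Y) \<le> cells_above t ?K" using X(2) cY by (intro cells_above_mono) simp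
  have "code v b < code v b'" using code_del(1)[OF w v o, of b] code_del(1)[OF w v o, of b'] b by simp
  moreover have "(\<Sum>b\<in>?Y. code v b) = code v b' + (\<Sum>b\<in>X - {b}. code v b)" using fin bX by simp
  moreover have "(\<Sum>b\<in>X. code v b) = code v b + (\<Sum>b\<in>X - {b}. code v b)" using sum.remove[OF fin bX(1)] .
  ultimately show False using 3 4 5 by linarith
qed

text \<open>Insertion transports the family of \<open>v\<close> injectively, and when
  \<open>n\<close> is strict the minimal tableau of \<open>w\<close> is outside the image. Dominance
  is the invariant that \<open>strict_value_new\<close> needs for this.\<close>

lemma strict_value_family:
  "w permutes {1..n} \<Longrightarrow> \<exists>F \<subseteq> red_tabs n w. Suc (card (strict_values n w)) \<le> card F \<and> (\<forall>t\<in>F. dominates_code n t w)"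
proof (induction n arbitrary: w)
  case 0
  obtain t where "t \<in> red_tabs 0 w" "dominates_code 0 t w" using minimal_tableau[OF 0] by blast
  then show ?case by (intro exI[of _ "{t}"]) (simp add: strict_values_def)
next
  case (Suc k)
  let ?n = "Suc k"
  let ?p = "inv w ?n"
  obtain v where v: "v permutes {1..?n - 1}" "w = v \<circ> cycle_to ?p ?n" "0 < ?p" "?p \<le> ?n"
    and o: "\<forall>a b. a \<noteq> ?n \<longrightarrow> b \<noteq> ?n \<longrightarrow> inv v a < inv v b \<longleftrightarrow> inv w a < inv w b"
    using del_max[OF Suc.prems] by blast
  obtain F where F: "F \<subseteq> red_tabs k v" "Suc (card (strict_values k v)) \<le> card F" "\<forall>t\<in>F. dominates_code k t v"
    using Suc.IH[of v] v(1) by auto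
  have Fs: "strict_tab t" "entries_below k t" "dominates_code k t v" if "t \<in> F" for t
    using that F(1,3) unfolding red_tabs_def by blast+
  let ?F = "insert_max ?p ?n ` F"
  have "inj_on (insert_max ?p ?n) F"
    using insert_max_inj[OF Fs(1) Fs(1) Fs(2) Fs(2)] by (intro inj_onI) blast
  then have cF: "card ?F = card F" by (rule card_image)
  have FG: "?F \<subseteq> red_tabs ?n w"
  proof (rule image_subsetI)
    fix t assume "t \<in> F"
    then have "t \<in> red_tabs (?n - 1) v" using F(1) by auto
    then show "insert_max ?p ?n t \<in> red_tabs ?n w" using red_tabs_insert_max[OF v(1) _ v(3,4), of t] v(2) by simp
  qed
  have Fd: "\<forall>t\<in>?F. dominates_code ?n t w"
    using dominates_code_insert_max[OF Suc.prems v(1) o _ _ _ v(3)] Fs by simp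
  have st: "strict_values ?n w = strict_values k v \<union> (if strict_value w ?n then {?n} else {})"
    unfolding strict_values_def using strict_value_transfer[OF o] by (auto simp: le_Suc_eq)
  have fs: "finite (strict_values k v)" "?n \<notin> strict_values k v" by (auto simp: strict_values_def)
  show ?case
  proof (cases "strict_value w ?n")
    case False
    then show ?thesis using FG Fd cF F(2) st by (intro exI[of _ ?F]) simp
  next
    case True
    obtain t where t: "t \<in> red_tabs ?n w" "dominates_code ?n t w" "attains_code ?n t w" using minimal_tableau[OF Suc.prems] by blast
    have "t \<notin> ?F"
      using strict_value_new[OF Suc.prems v(1) o _ _ _ v(3) True t(3)] Fs by auto
    moreover have "finite F"
      using F(2) by (intro card_ge_0_finite) simp
    ultimately have "card (insert t ?F) = Suc (card F)" using cF by simp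
    moreover have "card (strict_values ?n w) = Suc (card (strict_values k v))" using st True fs by simp
    ultimately show ?thesis using FG Fd F(2) t by (intro exI[of _ "insert t ?F"]) auto
  qed
qed

section \<open>Patterns and rectangles\<close>

lemma word_prod_fixed: "\<forall>x\<in>set xs. x = 0 \<or> Suc x < z \<Longrightarrow> word_prod xs z = z"
  by (induction xs) (auto simp: adj_swap_apply)

text \<open>The largest letter acts first. Once a letter has raised a point, the remaining letters
  are smaller and leave it where it is.\<close>

lemma word_prod_row_up: "strict_row f \<Longrightarrow> word_prod (map f [0..<b]) y \<le> Suc y"
proof (induction b arbitrary: y)
  case (Suc b)
  have e: "word_prod (map f [0..<Suc b]) y = word_prod (map f [0..<b]) (adj_swap (f b) y)" by simp
  show ?case
  proof (cases "f b \<noteq> 0 \<and> y = f b")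
    case True
    have "\<forall>x\<in>set (map f [0..<b]). x = 0 \<or> Suc x < Suc (f b)"
    proof
      fix x assume "x \<in> set (map f [0..<b])"
      then obtain j where "j < b" "x = f j" by auto
      then show "x = 0 \<or> Suc x < Suc (f b)"
        using strict_row_le[OF Suc.prems, of j "b - j"] True by auto
    qed
    from word_prod_fixed[OF this] show ?thesis unfolding e using True by (simp add: adj_swap_apply)
  next
    case False
    then have "adj_swap (f b) y \<le> y" by (auto simp: adj_swap_apply)
    then show ?thesis unfolding e using Suc.IH[OF Suc.prems, of "adj_swap (f b) y"] by linarith
  qed
qed simp

lemma word_prod_col_down: "strict_row f \<Longrightarrow> y \<le> Suc (word_prod (rev (map f [0..<b])) y)"
  using word_prod_row_up[of f b "word_prod (rev (map f [0..<b])) y"] fun_cong[OF word_prod_rev(2), of "map f [0..<b]" y] by simp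

lemma word_prod_row_word_up: "strict_tab t \<Longrightarrow> word_prod (row_word t a b) y \<le> y + a"
proof (induction a)
  case (Suc a)
  have "word_prod (row_word t (Suc a) b) y = word_prod (map (t a) [0..<b]) (word_prod (row_word t a b) y)" by (simp add: row_word_Suc)
  also have "\<dots> \<le> Suc (word_prod (row_word t a b) y)" by (rule word_prod_row_up[OF strict_tab_strict_row[OF Suc.prems]])
  finally show ?case using Suc.IH[OF Suc.prems] by linarith
qed simp

lemma word_prod_col_word_down: "strict_tab t \<Longrightarrow> y \<le> word_prod (col_word t a b) y + b"
proof (induction b arbitrary: y)
  case (Suc b)
  let ?y = "word_prod (map (\<lambda>i. t i b) (rev [0..<a])) y"
  have "flip_tab t b = (\<lambda>i. t i b)" by (simp add: flip_tab_def fun_eq_iff)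
  then have "strict_row (\<lambda>i. t i b)" using strict_tab_strict_row[of "flip_tab t" b] Suc.prems by simp
  then have "y \<le> Suc ?y" using word_prod_col_down[of "\<lambda>i. t i b" y a] by (simp add: rev_map)
  moreover have "?y \<le> word_prod (col_word t a b) ?y + b" by (rule Suc.IH[OF Suc.prems])
  moreover have "word_prod (col_word t a (Suc b)) y = word_prod (col_word t a b) ?y" by (simp add: col_word_Suc)
  ultimately show ?case by linarith
qed simp

lemma row_word_shift: "row_word t (a + d) b = row_word (\<lambda>i. t (a + i)) d b @ row_word t a b"
  by (induction d) (simp_all add: row_word_Suc)

lemma strict_tab_shift: "strict_tab t \<Longrightarrow> strict_tab (\<lambda>i. t (a + i))"
  unfolding strict_tab_def by (metis add_Suc_right)

lemma word_prod_col_word_narrow: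
  assumes "\<forall>i j. l \<le> j \<longrightarrow> t i j = 0"
  shows "word_prod (col_word t a (l + k)) = word_prod (col_word t a l)"
proof (induction k)
  case (Suc k)
  have "word_prod (map (\<lambda>i. t i (l + k)) (rev [0..<a])) = id" by (rule word_prod_zeros) (simp add: assms)
  then show ?case using Suc by (simp add: col_word_Suc)
qed simp

text \<open>
  If the cell were missing, \<open>v\<close> would factor into \<open>K - 1\<close> rows, each moving points up by at most 1,
  followed by \<open>L - 1\<close> columns, each moving points down by at most 1.
\<close>

lemma rectangle:
  assumes t: "strict_tab t" "word_prod (row_word t n n) = v" and v: "v permutes {1..n}"
    and K: "0 < K" "K \<le> Suc n" and L: "0 < L" "L \<le> Suc n"
    and Z: "K \<le> card {a. c < a \<and> v a \<le> d}" and O: "L \<le> card {a. a \<le> c \<and> d < v a}"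
  shows "t (K - 1) (L - 1) \<noteq> 0"
proof
  assume z: "t (K - 1) (L - 1) = 0"
  let ?Z = "{a. c < a \<and> v a \<le> d}" and ?O = "{a. a \<le> c \<and> d < v a}" and ?X = "{a. a \<le> c \<and> v a \<le> d}"
  have "{a. v a \<le> d} = inv v ` {..d}"
  proof (intro set_eqI iffI)
    fix x assume "x \<in> {a. v a \<le> d}"
    then show "x \<in> inv v ` {..d}" using inv_apply(2)[OF v, of x] by (intro image_eqI[of _ _ "v x"]) auto
  qed (auto simp: inv_apply(1)[OF v])
  \<comment> \<open>The fixed point 0 is counted, hence \<open>Suc d\<close>; it is counted in
    \<open>{..c}\<close> too and cancels later.\<close>
  then have low: "finite {a. v a \<le> d}" "card {a. v a \<le> d} = Suc d"
    using card_image[OF inj_on_subset[OF permutes_inj[OF permutes_inv[OF v]] subset_UNIV], of "{..d}"] by auto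
  have finZ: "finite ?Z" by (rule finite_subset[OF _ low(1)]) auto
  have finX: "finite ?X" by (rule finite_subset[OF _ low(1)]) auto
  have finO: "finite ?O" by (rule finite_subset[of _ "{..c}"]) auto
  have e1: "{a. v a \<le> d} = ?Z \<union> ?X" by auto
  have "?Z \<inter> ?X = {}" by auto
  from card_Un_disjoint[OF finZ finX this] have 1: "Suc d = card ?Z + card ?X"
    unfolding e1[symmetric] low(2) .
  have e2: "{..c} = ?O \<union> ?X" by auto
  have "?O \<inter> ?X = {}" by auto
  from card_Un_disjoint[OF finO finX this] have 2: "Suc c = card ?O + card ?X"
    unfolding e2[symmetric] card_atMost .
  define a where "a = K - 1"
  have "a \<le> n" "L - 1 \<le> n" using K L unfolding a_def by linarith+
  then obtain e k where e: "n = a + e" and k: "n = (L - 1) + k"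
    using le_Suc_ex[of a n] le_Suc_ex[of "L - 1" n] by blast
  let ?s = "\<lambda>i. t (a + i)"
  let ?up = "word_prod (row_word ?s e n)" and ?lo = "word_prod (row_word t a n)"
  have e3: "row_word t n n = row_word ?s e n @ row_word t a n" using row_word_shift[of t a e n] unfolding e[symmetric] .
  have vv: "v x = ?up (?lo x)" for x
    unfolding t(2)[symmetric] e3 by simp
  have sz: "\<forall>i j. L - 1 \<le> j \<longrightarrow> ?s i j = 0"
  proof (intro allI impI)
    fix i j assume "L - 1 \<le> j"
    then show "?s i j = 0"
      using strict_tab_le(1)[OF t(1), of "a + i" j a "L - 1"] z unfolding a_def[symmetric] by (cases "?s i j = 0") auto
  qed
  have "?up = word_prod (col_word ?s e n)" by (rule word_prod_row_word_col_word[OF strict_tab_shift[OF t(1)]])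
  also have "\<dots> = word_prod (col_word ?s e (L - 1))" using word_prod_col_word_narrow[OF sz, of e k] unfolding k[symmetric] .
  finally have down: "y \<le> ?up y + (L - 1)" for y
    using word_prod_col_word_down[OF strict_tab_shift[OF t(1)], of y a e "L - 1"] by simp
  have up: "?lo x \<le> x + a" for x by (rule word_prod_row_word_up[OF t(1)])
  \<comment> \<open>Pigeonhole: \<open>Suc c + card ?Z\<close> points cannot all land below
    \<open>c + card ?Z\<close>, and the points up to \<open>c\<close> rise by at most
    \<open>K - 1\<close>, which is less than \<open>card ?Z\<close>.\<close>
  have "\<exists>x\<in>?Z. c + card ?Z \<le> ?lo x"
  proof (rule ccontr)
    assume "\<not> ?thesis"
    then have "?lo x < c + card ?Z" if "x \<in> ?Z" for x using that not_le by blast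
    moreover have "?lo x < c + card ?Z" if "x \<le> c" for x
      using up[of x] that Z K unfolding a_def by linarith
    ultimately have "?lo ` ({..c} \<union> ?Z) \<subseteq> {..<c + card ?Z}" by blast
    moreover have "inj_on ?lo A" for A
      using fun_cong[OF word_prod_rev(1), of "row_word t a n"]
      by (intro inj_on_inverseI[of _ "word_prod (rev (row_word t a n))"]) simp
    ultimately have "card ({..c} \<union> ?Z) \<le> c + card ?Z"
      using card_inj_on_le[of ?lo "{..c} \<union> ?Z" "{..<c + card ?Z}"] by simp
    moreover have "card ({..c} \<union> ?Z) = Suc c + card ?Z" using finZ by (subst card_Un_disjoint) auto
    ultimately show False by simp
  qed
  then obtain x where x: "x \<in> ?Z" "c + card ?Z \<le> ?lo x" by blast
  \<comment> \<open>The two counts give \<open>c + card ?Z = d + card ?O\<close>, so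
    \<open>v x\<close> would exceed \<open>d\<close>.\<close>
  have "c + card ?Z \<le> v x + (L - 1)" using x(2) down[of "?lo x"] unfolding vv by linarith
  moreover have "v x \<le> d" using x(1) by simp
  ultimately show False using 1 2 O L by linarith
qed

text \<open>The values occur in the order \<open>a\<close>, \<open>b\<close>, \<open>z\<close>,
  \<open>m\<close>, a pattern 2143. For the least \<open>N\<close> above \<open>m\<close> placed
  between \<open>b\<close> and \<open>m\<close>, every value between \<open>m\<close> and
  \<open>N\<close> that is left of \<open>m\<close> is even left of \<open>b\<close>, and
  \<open>a\<close> counts for \<open>b\<close> only.\<close>

lemma pattern_strict_value:
  assumes w: "w permutes {1..n}" and "0 < b" "b < a" "a < m" "m < z"
    and "inv w a < inv w b" "inv w b < inv w z" "inv w z < inv w m"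
  shows "\<exists>N. m < N \<and> N \<le> z \<and> strict_value w N \<and> inv w b < inv w N \<and> inv w N < inv w m"
proof -
  let ?P = "\<lambda>N. m < N \<and> inv w b < inv w N \<and> inv w N < inv w m"
  define N where "N = (LEAST N. ?P N)"
  have N: "?P N" unfolding N_def by (rule LeastI[of ?P z]) (use assms in auto)
  have "N \<le> z" unfolding N_def by (rule Least_le) (use assms in auto)
  moreover have "code_below w N m < code_below w N b"
    unfolding code_below_def
  proof (rule psubset_card_mono)
    show "finite {z. b < z \<and> z < N \<and> inv w z < inv w b}" by (rule finite_subset[of _ "{..N}"]) auto
    have "inv w x < inv w b" if "m < x" "x < N" "inv w x < inv w m" for x
    proof -
      have "\<not> inv w b < inv w x" using not_less_Least[of x ?P] that unfolding N_def by blast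
      moreover have "inv w x \<noteq> inv w b"
        using permutes_inj[OF permutes_inv[OF w]] that assms by (metis injD less_asym less_trans)
      ultimately show ?thesis by simp
    qed
    moreover have "a \<in> {z. b < z \<and> z < N \<and> inv w z < inv w b}" using N assms by auto
    moreover have "a \<notin> {z. m < z \<and> z < N \<and> inv w z < inv w m}" using assms by auto
    ultimately show "{z. m < z \<and> z < N \<and> inv w z < inv w m} \<subset> {z. b < z \<and> z < N \<and> inv w z < inv w b}"
      using less_trans[OF assms(3,4)] by (intro psubsetI subsetI) (auto intro: less_trans)
  qed
  then have "strict_value w N" unfolding strict_value_def using N assms by (intro exI[of _ b] exI[of _ m]) auto
  ultimately show ?thesis using N by blast
qed

text \<open>Each hypothesis says that a box contains no point: positions between \<open>f\<close>
  and \<open>g\<close> with values between \<open>s\<close> and \<open>f\<close>, respectively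
  positions between \<open>Q\<close> and \<open>g\<close> with values between \<open>g\<close> and
  \<open>f\<close>. Passing to the inverse exchanges the two conditions.\<close>

lemma minimal_inversion_inverse:
  fixes n :: nat
  assumes w: "w permutes {1..n}"
    and M1: "\<forall>h. inv w f < inv w h \<and> inv w h < inv w g \<and> s < h \<longrightarrow> f < h"
    and M2: "\<forall>h. inv w Q < inv w h \<and> inv w h < inv w g \<and> g < h \<longrightarrow> f \<le> h"
  shows "\<forall>h. g < w h \<and> w h < f \<and> inv w Q < h \<longrightarrow> inv w g < h"
    and "\<forall>h. s < w h \<and> w h < f \<and> inv w f < h \<longrightarrow> inv w g \<le> h"
proof -
  note wi = inv_apply[OF w]
  show "\<forall>h. g < w h \<and> w h < f \<and> inv w Q < h \<longrightarrow> inv w g < h"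
  proof (intro allI impI, rule ccontr)
    fix h assume h: "g < w h \<and> w h < f \<and> inv w Q < h" and "\<not> inv w g < h"
    moreover have "h \<noteq> inv w g" using h wi(1)[of g] by auto
    ultimately show False using M2[rule_format, of "w h"] wi(2)[of h] by simp
  qed
  show "\<forall>h. s < w h \<and> w h < f \<and> inv w f < h \<longrightarrow> inv w g \<le> h"
  proof (intro allI impI, rule ccontr)
    fix h assume "s < w h \<and> w h < f \<and> inv w f < h" and "\<not> inv w g \<le> h"
    then show False using M1[rule_format, of "w h"] wi(2)[of h] by simp
  qed
qed

text \<open>
  The points are named by their values, and \<open>\<pi>\<close> gives the position of a value. Both \<open>a b P R\<close>
  and \<open>s Q f g\<close> form a pattern 2143, and the inversion \<open>f g\<close> is minimal south-east of \<open>s Q\<close>.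
\<close>

definition box_config :: "(nat \<Rightarrow> nat) \<Rightarrow> nat \<Rightarrow> nat \<Rightarrow> nat \<Rightarrow> nat \<Rightarrow> nat \<Rightarrow> nat \<Rightarrow> nat \<Rightarrow> nat \<Rightarrow> nat \<Rightarrow> bool" where
  "box_config \<pi> n a b P R s Q f g \<longleftrightarrow>
    0 < b \<and> b < a \<and> a < R \<and> R < P \<and> P < f \<and> f \<le> n \<and>
    \<pi> a < \<pi> b \<and> \<pi> b < \<pi> P \<and> \<pi> P < \<pi> R \<and> \<pi> R < \<pi> g \<and>
    0 < Q \<and> Q < s \<and> s < g \<and> g < f \<and> \<pi> s < \<pi> Q \<and> \<pi> Q < \<pi> f \<and> \<pi> f < \<pi> g \<and>
    (\<forall>h. \<pi> f < \<pi> h \<and> \<pi> h < \<pi> g \<and> s < h \<longrightarrow> f < h) \<and>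
    (\<forall>h. \<pi> Q < \<pi> h \<and> \<pi> h < \<pi> g \<and> g < h \<longrightarrow> f \<le> h)"

lemma box_config_transfer:
  assumes v: "v permutes {1..n - 1}"
    and o: "\<forall>a b. a \<noteq> n \<longrightarrow> b \<noteq> n \<longrightarrow> inv v a < inv v b \<longleftrightarrow> inv w a < inv w b"
    and B: "box_config (inv w) n a b P R s Q f g" and f: "f \<noteq> n"
  shows "box_config (inv v) (n - 1) a b P R s Q f g"
proof -
  have lt: "a < n" "b < n" "P < n" "R < n" "s < n" "Q < n" "f < n" "g < n"
    using B f unfolding box_config_def by linarith+
  have o': "inv v x < inv v y \<longleftrightarrow> inv w x < inv w y" if "x < n" "y < n" for x y
    using o that by simp
  have "g \<le> n - 1" using lt by simp
  then have gn: "inv v g < n" using permutes_le[OF permutes_inv[OF v], of g] lt by linarith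
  have vn: "inv v n = n" using permutes_out(1)[OF permutes_inv[OF v], of n] lt by simp
  \<comment> \<open>In \<open>v\<close> the value \<open>n\<close> sits at position
    \<open>n\<close>, right of \<open>g\<close>, where the minimality conditions do not
    look.\<close>
  have ne: "h \<noteq> n" if "inv v h < inv v g" for h using that gn vn by auto
  have 1: "\<forall>h. inv v f < inv v h \<and> inv v h < inv v g \<and> s < h \<longrightarrow> f < h"
  proof (intro allI impI)
    fix h assume h: "inv v f < inv v h \<and> inv v h < inv v g \<and> s < h"
    then have "h \<noteq> n" using ne by blast
    then have "inv w f < inv w h" "inv w h < inv w g" using h o f lt by auto
    then show "f < h" using h B unfolding box_config_def by blast
  qed
  have 2: "\<forall>h. inv v Q < inv v h \<and> inv v h < inv v g \<and> g < h \<longrightarrow> f \<le> h"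
  proof (intro allI impI)
    fix h assume h: "inv v Q < inv v h \<and> inv v h < inv v g \<and> g < h"
    then have "h \<noteq> n" using ne by blast
    then have "inv w Q < inv w h" "inv w h < inv w g" using h o lt by auto
    then show "f \<le> h" using h B unfolding box_config_def by blast
  qed
  have B': "0 < b \<and> b < a \<and> a < R \<and> R < P \<and> P < f"
    "inv w a < inv w b \<and> inv w b < inv w P \<and> inv w P < inv w R \<and> inv w R < inv w g"
    "0 < Q \<and> Q < s \<and> s < g \<and> g < f" "inv w s < inv w Q \<and> inv w Q < inv w f \<and> inv w f < inv w g"
    using B unfolding box_config_def by blast+
  have f': "f \<le> n - 1" using lt by simp
  show ?thesis unfolding box_config_def using B' 1 2 f' by (simp only: o' lt)
qed

lemma box_config_inverse:
  assumes w: "w permutes {1..n}" and B: "box_config (inv w) n a b P R s Q f g"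
  shows "box_config w n (inv w b) (inv w a) (inv w R) (inv w P) (inv w Q) (inv w s) (inv w g) (inv w f)"
proof -
  note wi = inv_apply[OF w]
  have B': "0 < b" "b < a" "a < R" "R < P" "P < f" "f \<le> n"
    "inv w a < inv w b" "inv w b < inv w P" "inv w P < inv w R" "inv w R < inv w g"
    "0 < Q" "Q < s" "s < g" "g < f" "inv w s < inv w Q" "inv w Q < inv w f" "inv w f < inv w g"
    and M1: "\<forall>h. inv w f < inv w h \<and> inv w h < inv w g \<and> s < h \<longrightarrow> f < h"
    and M2: "\<forall>h. inv w Q < inv w h \<and> inv w h < inv w g \<and> g < h \<longrightarrow> f \<le> h"
    using B unfolding box_config_def by blast+
  have pos: "0 < inv w x" "inv w x \<le> n" if "0 < x" "x \<le> n" for x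
    using permutes_in[OF permutes_inv[OF w] that] by auto
  have 1: "inv w g < h" if "g < w h" "w h < f" "inv w Q < h" for h
    using minimal_inversion_inverse(1)[OF w M1 M2] that by blast
  have 2: "inv w g \<le> h" if "s < w h" "w h < f" "inv w f < h" for h
    using minimal_inversion_inverse(2)[OF w M1 M2] that by blast
  show ?thesis unfolding box_config_def wi
    using B' 1 2 pos[of a] pos[of s] pos[of g] by auto
qed

section \<open>Chains of essential cells\<close>

lemma card_strict_value:
  assumes "w permutes {1..n}" "A \<subseteq> strict_values n w" shows "Suc (card A) \<le> card (red_tabs n w)"
proof -
  obtain F where F: "F \<subseteq> red_tabs n w" "Suc (card (strict_values n w)) \<le> card F"
    using strict_value_family[OF assms(1)] by blast
  have "card A \<le> card (strict_values n w)" using assms(2) by (intro card_mono) (auto simp: strict_values_def)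
  moreover have "card F \<le> card (red_tabs n w)" using F(1) by (intro card_mono red_tabs_EG(1))
  ultimately show ?thesis using F(2) by linarith
qed

lemma card_red_tabs_three:
  assumes "w permutes {1..n}" "0 < x" "x < y" "y < z" "z \<le> n" "strict_value w x" "strict_value w y" "strict_value w z"
  shows "4 \<le> card (red_tabs n w)"
  using card_strict_value[OF assms(1), of "{x, y, z}"] assms by (simp add: strict_values_def)

lemma card_red_tabs_2143:
  assumes w: "w permutes {1..n}" and "0 < b" "b < a" "a < m" "m < z" "z \<le> n"
    and "inv w a < inv w b" "inv w b < inv w z" "inv w z < inv w m"
  shows "2 \<le> card (red_tabs n w)"
proof -
  obtain N where "m < N" "N \<le> z" "strict_value w N"
    using pattern_strict_value[OF w assms(2-5) assms(7-9)] by blast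
  then show ?thesis using card_strict_value[OF w, of "{N}"] assms by (simp add: strict_values_def)
qed

lemma card_red_tabs_inv:
  assumes w: "w permutes {1..n}" shows "card (red_tabs n (inv w)) = card (red_tabs n w)"
proof -
  have "bij_betw flip_tab (red_tabs n w) (red_tabs n (inv w))"
    using red_tabs_flip_tab[OF w] red_tabs_flip_tab[OF permutes_inv[OF w]] permutes_inv_inv[OF w]
    by (intro bij_betwI[of _ _ _ flip_tab]) auto
  then show ?thesis using bij_betw_same_card by metis
qed

lemma insert_max_image:
  assumes "v permutes {1..n - 1}" "0 < p" "p \<le> n"
  shows "insert_max p n ` red_tabs (n - 1) v \<subseteq> red_tabs n (v \<circ> cycle_to p n)"
    "card (insert_max p n ` red_tabs (n - 1) v) = card (red_tabs (n - 1) v)"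
proof -
  show "insert_max p n ` red_tabs (n - 1) v \<subseteq> red_tabs n (v \<circ> cycle_to p n)"
    using red_tabs_insert_max[OF assms(1) _ assms(2,3)] by blast
  have "inj_on (insert_max p n) (red_tabs (n - 1) v)"
  proof (rule inj_onI)
    fix t s assume "t \<in> red_tabs (n - 1) v" "s \<in> red_tabs (n - 1) v" and e: "insert_max p n t = insert_max p n s"
    then have "strict_tab t" "strict_tab s" "entries_below (n - 1) t" "entries_below (n - 1) s" unfolding red_tabs_def by blast+
    then show "t = s" by (rule insert_max_inj[OF _ _ _ _ e])
  qed
  then show "card (insert_max p n ` red_tabs (n - 1) v) = card (red_tabs (n - 1) v)" by (rule card_image)
qed

text \<open>
  The first insertion puts \<open>n - 1\<close> into row \<open>n - p\<close>, which by the rectangle lemma happens to the right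
  of column \<open>n - g\<close>; there the second insertion leaves only letters below \<open>n - 1\<close>.
\<close>

lemma disjoint_images:
  assumes w: "w permutes {1..n}" and v: "v permutes {1..n - 1}"
    and iv: "\<forall>b. inv v b = cycle_to (inv w n) n (inv w b)"
    and B: "box_config (inv w) n a b P R s Q n g" and g: "inv w g = n"
    and t: "t \<in> red_tabs (n - 1) v" and t': "strict_tab t'" "entries_below (n - 1) t'"
  shows "insert_max (inv w n) n t \<noteq> flip_tab (insert_max g n t')"
proof
  let ?\<pi> = "inv w"
  let ?p = "?\<pi> n"
  assume eq: "insert_max ?p n t = flip_tab (insert_max g n t')"
  have B': "0 < Q" "Q < s" "s < g" "g < n" "?\<pi> s < ?\<pi> Q" "?\<pi> Q < ?p" "?p < n"
    and M1: "\<And>h. ?p < ?\<pi> h \<Longrightarrow> ?\<pi> h < n \<Longrightarrow> s < h \<Longrightarrow> n < h"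
    and M2: "\<And>h. ?\<pi> Q < ?\<pi> h \<Longrightarrow> ?\<pi> h < n \<Longrightarrow> g < h \<Longrightarrow> n \<le> h"
    using B g unfolding box_config_def by auto
  note wi = inv_apply[OF w] and vi = inv_apply[OF v]
  have injv: "inj_on (inv v) A" for A
    by (rule inj_on_subset[OF permutes_inj[OF permutes_inv[OF v]] subset_UNIV])
  have fin: "finite {x. v x \<le> d}" for d
  proof (rule finite_subset)
    show "{x. v x \<le> d} \<subseteq> inv v ` {..d}"
      using vi(2) by (metis (mono_tags, lifting) atMost_iff image_eqI mem_Collect_eq subsetI)
  qed simp
  have posQ: "0 < ?\<pi> Q" using B'(5) by simp
  \<comment> \<open>This cut separates \<open>s\<close> from \<open>Q\<close>. \<open>Q\<close> and
    the \<open>n - ?p - 1\<close> values strictly between \<open>n\<close> and the last position are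
    later and smaller; \<open>s\<close> and the \<open>n - g - 1\<close> values strictly between
    \<open>g\<close> and \<open>n\<close> are earlier and larger. So \<open>Q\<close> and
    \<open>s\<close> each supply the one point by which the counts reach \<open>n - ?p\<close> and
    \<open>n - g\<close>.\<close>
  let ?c = "?\<pi> Q - 1" and ?d = "s - 1"
  have ts: "strict_tab t" "entries_below (n - 1) t" "word_prod (row_word t (n - 1) (n - 1)) = v" using t unfolding red_tabs_def by blast+
  have Z: "n - ?p \<le> card {x. ?c < x \<and> v x \<le> ?d}"
  proof -
    let ?B = "insert Q (w ` {?p<..<n})"
    have "Q \<notin> w ` {?p<..<n}"
    proof
      assume "Q \<in> w ` {?p<..<n}"
      then obtain x where "?p < x" "Q = w x" by auto
      then show False using wi(2)[of x] B'(6) by simp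
    qed
    moreover have "card (w ` {?p<..<n}) = n - Suc ?p"
      using card_image[OF inj_on_subset[OF permutes_inj[OF w] subset_UNIV], of "{?p<..<n}"] by simp
    ultimately have "card ?B = n - ?p" using B'(7) by simp
    then have "card (inv v ` ?B) = n - ?p" using card_image[OF injv, of ?B] by simp
    moreover have "inv v ` ?B \<subseteq> {x. ?c < x \<and> v x \<le> ?d}"
    proof (rule image_subsetI)
      fix b assume "b \<in> ?B"
      then consider "b = Q" | x where "?p < x" "x < n" "b = w x" by auto
      then show "inv v b \<in> {x. ?c < x \<and> v x \<le> ?d}"
      proof cases
        case 1
        then show ?thesis using B' posQ iv[rule_format, of Q] vi(1)[of Q] by (simp add: cycle_to_def)
      next
        case 2
        have x: "?\<pi> b = x" using 2 wi(2)[of x] by simp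
        have "b \<le> n" using permutes_le[OF w, of x] 2 by simp
        then have "\<not> s < b" using M1[of b] x 2 by auto
        moreover have "b \<noteq> s" using x 2 B' by auto
        ultimately have "b < s" by simp
        moreover have "inv v b = x - 1" using iv[rule_format, of b] x 2 by (simp add: cycle_to_def)
        ultimately show ?thesis using 2 B' posQ vi(1)[of b] by auto
      qed
    qed
    moreover have "finite {x. ?c < x \<and> v x \<le> ?d}" by (rule finite_subset[OF _ fin[of ?d]]) auto
    ultimately show ?thesis using card_mono by metis
  qed
  have O: "n - g \<le> card {x. x \<le> ?c \<and> ?d < v x}"
  proof -
    let ?B = "insert s {g<..<n}"
    have "card ?B = n - g" using B' by simp
    then have "card (inv v ` ?B) = n - g" using card_image[OF injv, of ?B] by simp
    moreover have "inv v ` ?B \<subseteq> {x. x \<le> ?c \<and> ?d < v x}"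
    proof (rule image_subsetI)
      fix h assume h: "h \<in> ?B"
      then have hs: "s \<le> h" "Q < h" using B' by auto
      have "?\<pi> h < ?\<pi> Q"
      proof (cases "h = s")
        case True
        then show ?thesis using B' by simp
      next
        case False
        then have hg: "g < h" "h < n" using h by auto
        have "?\<pi> h \<le> n" using permutes_le[OF permutes_inv[OF w], of h] hg by simp
        moreover have "?\<pi> h \<noteq> n" using wi(1)[of h] wi(1)[of g] g hg by auto
        ultimately have "\<not> ?\<pi> Q < ?\<pi> h" using M2[of h] hg by auto
        moreover have "?\<pi> h \<noteq> ?\<pi> Q" using wi(1)[of h] wi(1)[of Q] hs by auto
        ultimately show ?thesis by simp
      qed
      moreover from this have "inv v h = ?\<pi> h" using iv[rule_format, of h] B' by (simp add: cycle_to_def)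
      ultimately show "inv v h \<in> {x. x \<le> ?c \<and> ?d < v x}" using hs B' vi(1)[of h] by auto
    qed
    moreover have "finite {x. x \<le> ?c \<and> ?d < v x}" by (rule finite_subset[of _ "{..?c}"]) auto
    ultimately show ?thesis using card_mono by metis
  qed
  let ?K = "n - ?p" and ?L = "n - g"
  have nz: "t (?K - 1) (?L - 1) \<noteq> 0"
    by (rule rectangle[OF ts(1,3) v _ _ _ _ Z O]) (use B' in auto)
  define r where "r = row_len t (?K - 1)"
  have rL: "?L \<le> r" using nz nz_iff_row_len[OF ts(1,2), of "?K - 1" "?L - 1"] B' unfolding r_def by simp
  then obtain q where q: "r = Suc q" using B'(4) by (cases r) auto
  have "t (?K - 1) r = 0" "t (?K - 1) q \<noteq> 0"
    using nz_iff_row_len[OF ts(1,2), of "?K - 1"] q unfolding r_def[symmetric] by auto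
  moreover have "t (?K - 1) q < n - 1" using entries_belowD[OF ts(2)] calculation(2) by blast
  moreover have "?p + (?K - 1) = n - 1" using B' by simp
  ultimately have 1: "insert_max ?p n t (?K - 1) r = n - 1" using B' q by (simp add: insert_max_def insert_row_def)
  have "\<not> g + r < n" using rL by linarith
  then have "insert_max g n t' r (?K - 1) = t' r (?K - 1)" by (simp add: insert_max_def)
  then have 2: "insert_max ?p n t (?K - 1) r = t' r (?K - 1)" unfolding eq by (simp add: flip_tab_def)
  have nz': "n - 1 \<noteq> 0" using B' by simp
  have e: "t' r (?K - 1) = n - 1" using 1 unfolding 2 .
  show False using entries_belowD[OF t'(2), of r "?K - 1"] nz' unfolding e by blast
qed

text \<open>The pattern formed by \<open>a\<close>, \<open>b\<close>, \<open>P\<close>,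
  \<open>R\<close> survives because \<open>P < f \<le> n\<close>. For the inverse the same role is
  played by the condition that \<open>R\<close> is left of \<open>g\<close>.\<close>

lemma box_config_pattern_del:
  assumes v: "v permutes {1..n - 1}"
    and o: "\<forall>a b. a \<noteq> n \<longrightarrow> b \<noteq> n \<longrightarrow> inv v a < inv v b \<longleftrightarrow> inv w a < inv w b"
    and B: "box_config (inv w) n a b P R s Q f g"
  shows "2 \<le> card (red_tabs (n - 1) v)"
proof -
  have B': "0 < b" "b < a" "a < R" "R < P" "P < n" "inv w a < inv w b" "inv w b < inv w P" "inv w P < inv w R"
    using B unfolding box_config_def by auto
  have "inv v x < inv v y \<longleftrightarrow> inv w x < inv w y" if "x < n" "y < n" for x y using o that by simp
  then show ?thesis using card_red_tabs_2143[OF v B'(1-4)] B' by simp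
qed

text \<open>If \<open>f\<close> is not the top value, delete that value; if \<open>g\<close> is not
  in the last position, delete that position. Either way the configuration survives. When both are
  extreme, each deletion leaves two tableaux, and the images are disjoint.\<close>

lemma card_red_tabs_box_config:
  "w permutes {1..n} \<Longrightarrow> box_config (inv w) n a b P R s Q f g \<Longrightarrow> 4 \<le> card (red_tabs n w)"
proof (induction n arbitrary: w a b P R s Q f g)
  case 0
  then show ?case unfolding box_config_def by simp
next
  case (Suc k)
  let ?n = "Suc k"
  note w = Suc.prems(1) and B = Suc.prems(2)
  have step: "4 \<le> card (red_tabs ?n u)" if u: "u permutes {1..?n}" "box_config (inv u) ?n a b P R s Q f g" "f \<noteq> ?n"
    for u a b P R s Q f g
  proof -
    obtain v where v: "v permutes {1..?n - 1}" "u = v \<circ> cycle_to (inv u ?n) ?n" "0 < inv u ?n" "inv u ?n \<le> ?n"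
      and o: "\<forall>a b. a \<noteq> ?n \<longrightarrow> b \<noteq> ?n \<longrightarrow> inv v a < inv v b \<longleftrightarrow> inv u a < inv u b"
      using del_max[OF u(1)] by blast
    have "4 \<le> card (red_tabs k v)" using Suc.IH[of v] box_config_transfer[OF v(1) o u(2,3)] v(1) by simp
    also have "\<dots> \<le> card (red_tabs ?n u)"
      using insert_max_image[OF v(1,3,4)] v(2) card_mono[OF red_tabs_EG(1)] by (metis diff_Suc_1)
    finally show ?thesis .
  qed
  have iu: "inv (inv w) = w" using permutes_inv_inv[OF w] .
  have u: "inv w permutes {1..?n}" using permutes_inv[OF w] .
  have B2: "box_config (inv (inv w)) ?n (inv w b) (inv w a) (inv w R) (inv w P) (inv w Q) (inv w s) (inv w g) (inv w f)"
    unfolding iu by (rule box_config_inverse[OF w B])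
  show ?case
  proof (cases "f = ?n \<and> inv w g = ?n")
    case False
    then show ?thesis using step[OF w B] step[OF u B2] card_red_tabs_inv[OF w] by auto
  next
    case True
    then have f: "f = ?n" and g: "inv w g = ?n" by auto
    have wn: "w ?n = g" using g inv_apply(1)[OF w, of g] by simp
    obtain v where v: "v permutes {1..?n - 1}" "w = v \<circ> cycle_to (inv w ?n) ?n" "0 < inv w ?n" "inv w ?n \<le> ?n"
      and iv: "\<forall>b. inv v b = cycle_to (inv w ?n) ?n (inv w b)"
      and o: "\<forall>a b. a \<noteq> ?n \<longrightarrow> b \<noteq> ?n \<longrightarrow> inv v a < inv v b \<longleftrightarrow> inv w a < inv w b"
      using del_max[OF w] by blast
    obtain v' where v': "v' permutes {1..?n - 1}" "inv w = v' \<circ> cycle_to g ?n" "0 < g" "g \<le> ?n"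
      and o': "\<forall>a b. a \<noteq> ?n \<longrightarrow> b \<noteq> ?n \<longrightarrow> inv v' a < inv v' b \<longleftrightarrow> inv (inv w) a < inv (inv w) b"
      using del_max[OF u] unfolding iu wn by auto
    let ?A = "insert_max (inv w ?n) ?n ` red_tabs (?n - 1) v" and ?B = "flip_tab ` insert_max g ?n ` red_tabs (?n - 1) v'"
    have cA: "2 \<le> card ?A"
      unfolding insert_max_image(2)[OF v(1,3,4)] by (rule box_config_pattern_del[OF v(1) o B])
    have "card ?B = card (insert_max g ?n ` red_tabs (?n - 1) v')"
      by (rule card_image) (metis inj_onI flip_tab_flip_tab)
    then have cB: "2 \<le> card ?B"
      unfolding insert_max_image(2)[OF v'(1,3,4)] using box_config_pattern_del[OF v'(1) o' B2] by simp
    have A: "?A \<subseteq> red_tabs ?n w" using insert_max_image(1)[OF v(1,3,4)] v(2) by simp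
    have "insert_max g ?n ` red_tabs (?n - 1) v' \<subseteq> red_tabs ?n (inv w)" using insert_max_image(1)[OF v'(1,3,4)] v'(2) by simp
    then have Bsub: "?B \<subseteq> red_tabs ?n w" using red_tabs_flip_tab[OF u] unfolding iu by blast
    have "?A \<inter> ?B = {}"
    proof -
      have "insert_max (inv w ?n) ?n t \<noteq> flip_tab (insert_max g ?n t')" if "t \<in> red_tabs (?n - 1) v" "t' \<in> red_tabs (?n - 1) v'" for t t'
      proof (rule disjoint_images[OF w v(1) iv _ g that(1)])
        show "box_config (inv w) ?n a b P R s Q ?n g" using B unfolding f .
        show "strict_tab t'" "entries_below (?n - 1) t'" using that(2) unfolding red_tabs_def by blast+
      qed
      then show ?thesis by blast
    qed
    then have "card (?A \<union> ?B) = card ?A + card ?B"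
      using finite_subset[OF A red_tabs_EG(1)] finite_subset[OF Bsub red_tabs_EG(1)] by (intro card_Un_disjoint)
    moreover have "card (?A \<union> ?B) \<le> card (red_tabs ?n w)" using A Bsub by (intro card_mono red_tabs_EG(1)) blast
    ultimately show ?thesis using cA cB by linarith
  qed
qed

text \<open>
  Here \<open>P\<close>, \<open>Q\<close> are the values in the row of an essential cell and in the row below it, and \<open>R\<close>, \<open>s\<close> are
  the values of its column and of the column to its right. Possibly \<open>P = s\<close> or \<open>Q = R\<close>.
\<close>

definition chain_config :: "(nat \<Rightarrow> nat) \<Rightarrow> nat \<Rightarrow> nat \<Rightarrow> nat \<Rightarrow> nat \<Rightarrow> nat \<Rightarrow> nat \<Rightarrow> nat \<Rightarrow> nat \<Rightarrow> nat \<Rightarrow> bool" where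
  "chain_config \<pi> n a b P R s Q f g \<longleftrightarrow>
    0 < b \<and> b < a \<and> a < R \<and> R < P \<and> P \<le> n \<and> f \<le> n \<and>
    \<pi> a < \<pi> b \<and> \<pi> b < \<pi> P \<and> \<pi> P < \<pi> R \<and>
    0 < Q \<and> Q \<le> R \<and> s = Suc R \<and> s \<le> P \<and> \<pi> Q = Suc (\<pi> P) \<and> \<pi> s \<le> \<pi> P \<and> \<pi> Q \<le> \<pi> R \<and>
    s < g \<and> g < f \<and> \<pi> Q < \<pi> f \<and> \<pi> f < \<pi> g \<and>
    (\<forall>h. \<pi> f < \<pi> h \<and> \<pi> h < \<pi> g \<and> s < h \<longrightarrow> f < h) \<and>
    (\<forall>h. \<pi> Q < \<pi> h \<and> \<pi> h < \<pi> g \<and> g < h \<longrightarrow> f \<le> h)"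

lemma chain_config_inverse:
  assumes w: "w permutes {1..n}" and B: "chain_config (inv w) n a b P R s Q f g"
  shows "chain_config w n (inv w b) (inv w a) (inv w R) (inv w P) (inv w Q) (inv w s) (inv w g) (inv w f)"
proof -
  note wi = inv_apply[OF w]
  have B': "0 < b" "b < a" "a < R" "R < P" "P \<le> n" "f \<le> n"
    "inv w a < inv w b" "inv w b < inv w P" "inv w P < inv w R" "0 < Q" "Q \<le> R" "s = Suc R" "s \<le> P"
    "inv w Q = Suc (inv w P)" "inv w s \<le> inv w P" "inv w Q \<le> inv w R"
    "s < g" "g < f" "inv w Q < inv w f" "inv w f < inv w g"
    and M1: "\<forall>h. inv w f < inv w h \<and> inv w h < inv w g \<and> s < h \<longrightarrow> f < h"
    and M2: "\<forall>h. inv w Q < inv w h \<and> inv w h < inv w g \<and> g < h \<longrightarrow> f \<le> h"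
    using B unfolding chain_config_def by blast+
  have pos: "0 < inv w x" "inv w x \<le> n" if "0 < x" "x \<le> n" for x
    using permutes_in[OF permutes_inv[OF w] that] by auto
  have 1: "inv w g < h" if "g < w h" "w h < f" "inv w Q < h" for h
    using minimal_inversion_inverse(1)[OF w M1 M2] that by blast
  have 2: "inv w g \<le> h" if "s < w h" "w h < f" "inv w f < h" for h
    using minimal_inversion_inverse(2)[OF w M1 M2] that by blast
  show ?thesis unfolding chain_config_def wi
    using B' 1 2 pos[of a] pos[of s] pos[of g] pos[of R] by auto
qed

lemma pattern_strict_value_inv:
  assumes w: "w permutes {1..n}" and "0 < x" "x < y" "y < m" "m < z"
    and "w y < w x" "w x < w z" "w z < w m"
  shows "\<exists>N. m < N \<and> N \<le> z \<and> strict_value (inv w) N \<and> w x < w N \<and> w N < w m"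
  using pattern_strict_value[OF permutes_inv[OF w] assms(2-5)] assms(6-8)
  unfolding permutes_inv_inv[OF w] by blast

text \<open>The pair \<open>a\<close>, \<open>b\<close> followed by \<open>f\<close>,
  \<open>g\<close> or by \<open>P\<close>, \<open>f\<close> gives strict values in
  \<open>(g, f]\<close> and \<open>(f, P]\<close>. A third one in \<open>(R, g]\<close> arises if
  \<open>g\<close> or \<open>s\<close> lies between \<open>b\<close> and \<open>R\<close>. In the
  remaining case \<open>s\<close> lies left of \<open>b\<close>, and positions replace
  values.\<close>

lemma card_red_tabs_chain_config_above:
  assumes w: "w permutes {1..n}" and B: "chain_config (inv w) n a b P R s Q f g" and P: "f < P"
  shows "4 \<le> card (red_tabs n w)"
proof -
  let ?\<pi> = "inv w"
  note wi = inv_apply[OF w]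
  have B': "0 < b" "b < a" "a < R" "R < P" "P \<le> n" "f \<le> n"
    "?\<pi> a < ?\<pi> b" "?\<pi> b < ?\<pi> P" "?\<pi> P < ?\<pi> R" "0 < Q" "Q \<le> R" "s = Suc R" "s \<le> P"
    "?\<pi> Q = Suc (?\<pi> P)" "?\<pi> s \<le> ?\<pi> P" "?\<pi> Q \<le> ?\<pi> R"
    "s < g" "g < f" "?\<pi> Q < ?\<pi> f" "?\<pi> f < ?\<pi> g"
    and M1: "\<And>h. ?\<pi> f < ?\<pi> h \<Longrightarrow> ?\<pi> h < ?\<pi> g \<Longrightarrow> s < h \<Longrightarrow> f < h"
    using B unfolding chain_config_def by blast+
  have fromN1: "4 \<le> card (red_tabs n w)" if "R < N1" "N1 \<le> g" "strict_value w N1" for N1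
  proof -
    obtain N2 where N2: "g < N2" "N2 \<le> f" "strict_value w N2"
      using pattern_strict_value[OF w B'(1,2), of g f] B' by auto
    obtain N3 where N3: "f < N3" "N3 \<le> P" "strict_value w N3"
      using pattern_strict_value[OF w B'(1,2), of f P] B' P by auto
    show ?thesis using card_red_tabs_three[OF w _ _ _ _ that(3) N2(3) N3(3)] that N2 N3 B' by linarith
  qed
  consider "?\<pi> g < ?\<pi> R" | "?\<pi> R < ?\<pi> g" "?\<pi> b < ?\<pi> s" | "?\<pi> R < ?\<pi> g" "?\<pi> s < ?\<pi> b"
  proof -
    have "?\<pi> g \<noteq> ?\<pi> R" using wi(1)[of g] wi(1)[of R] B' by auto
    moreover have "?\<pi> b \<noteq> ?\<pi> s" using wi(1)[of b] wi(1)[of s] B' by auto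
    ultimately show thesis using that by linarith
  qed
  then show ?thesis
  proof cases
    case 1
    obtain N1 where "R < N1" "N1 \<le> g" "strict_value w N1"
      using pattern_strict_value[OF w B'(1-3), of g] B' 1 by auto
    then show ?thesis by (rule fromN1)
  next
    case 2
    obtain N1 where "R < N1" "N1 \<le> s" "strict_value w N1"
      using pattern_strict_value[OF w B'(1-3), of s] B' 2 by auto
    then show ?thesis using fromN1[of N1] B' by simp
  next
    case 3
    \<comment> \<open>Now \<open>s\<close>, \<open>b\<close> is an inversion left of
      \<open>P\<close>, \<open>f\<close>, \<open>g\<close>. Taken instead of \<open>a\<close>,
      \<open>b\<close> it yields strict values of \<open>inv w\<close>, that is positions, which
      carry entries above \<open>s\<close>.\<close>
    have pos: "0 < ?\<pi> s" "0 < ?\<pi> a" "?\<pi> g \<le> n"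
      using permutes_in[OF permutes_inv[OF w], of s] permutes_in[OF permutes_inv[OF w], of a]
        permutes_in[OF permutes_inv[OF w], of g] B' by auto
    have lt: "?\<pi> P < ?\<pi> f" using B' by simp
    obtain x where x: "?\<pi> P < x" "x \<le> ?\<pi> f" "strict_value ?\<pi> x" "s < w x" "w x < P"
      using pattern_strict_value_inv[OF w pos(1) 3(2) B'(8) lt] P B' unfolding wi by auto
    have bf: "?\<pi> b < ?\<pi> f" using B' by simp
    obtain z where z: "?\<pi> f < z" "z \<le> ?\<pi> g" "strict_value ?\<pi> z" "s < w z" "w z < f"
      using pattern_strict_value_inv[OF w pos(1) 3(2) bf B'(20)] B' unfolding wi by auto
    \<comment> \<open>Minimality of the inversion leaves no position strictly between
      \<open>f\<close> and \<open>g\<close> with an entry between \<open>s\<close> and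
      \<open>f\<close>, so \<open>z\<close> is beyond the position of \<open>R\<close>.\<close>
    have zg: "z = ?\<pi> g"
    proof (rule ccontr)
      assume "z \<noteq> ?\<pi> g"
      then show False using M1[of "w z"] z wi(2)[of z] by simp
    qed
    have Rx: "?\<pi> R \<noteq> x" using x(4) wi(1)[of R] B' by auto
    have ui: "card (red_tabs n ?\<pi>) = card (red_tabs n w)" by (rule card_red_tabs_inv[OF w])
    note three = card_red_tabs_three[OF permutes_inv[OF w], unfolded ui]
    \<comment> \<open>The third strict position is sought up to that of \<open>R\<close>, on the
      side where it differs from \<open>x\<close>: after \<open>x\<close> with the entry at
      \<open>x\<close> in the role of \<open>P\<close>, or before \<open>x\<close> with
      \<open>P\<close> itself.\<close>
    show ?thesis
    proof (cases "x < ?\<pi> R")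
      case True
      have bx: "?\<pi> b < x" using B' x by simp
      obtain y where "x < y" "y \<le> ?\<pi> R" "strict_value ?\<pi> y"
        using pattern_strict_value_inv[OF w pos(2) B'(7) bx True] x B' unfolding wi by auto
      then show ?thesis using three[of x y z] x z zg 3 pos by simp
    next
      case False
      obtain y where "?\<pi> P < y" "y \<le> ?\<pi> R" "strict_value ?\<pi> y"
        using pattern_strict_value_inv[OF w pos(2) B'(7,8,9)] B' unfolding wi by auto
      then show ?thesis using three[of y x z] x z zg 3 pos False Rx by simp
    qed
  qed
qed

text \<open>Passing to the inverse exchanges the case \<open>f < P\<close> with the case that
  \<open>g\<close> is left of \<open>R\<close>. If neither holds, the two patterns are placed as in
  \<open>box_config\<close>.\<close>

lemma card_red_tabs_chain_config:
  assumes w: "w permutes {1..n}" and B: "chain_config (inv w) n a b P R s Q f g"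
  shows "4 \<le> card (red_tabs n w)"
proof -
  have iu: "inv (inv w) = w" using permutes_inv_inv[OF w] .
  have B2: "chain_config (inv (inv w)) n (inv w b) (inv w a) (inv w R) (inv w P) (inv w Q) (inv w s) (inv w g) (inv w f)"
    unfolding iu by (rule chain_config_inverse[OF w B])
  have ne: "P \<noteq> f" "inv w R \<noteq> inv w g"
    using B inv_apply(1)[OF w, of R] inv_apply(1)[OF w, of g] unfolding chain_config_def by auto
  consider "f < P" | "inv w g < inv w R" | "P < f" "inv w R < inv w g" using ne by linarith
  then show ?thesis
  proof cases
    case 1
    then show ?thesis using card_red_tabs_chain_config_above[OF w B] by simp
  next
    case 2
    then show ?thesis using card_red_tabs_chain_config_above[OF permutes_inv[OF w] B2] card_red_tabs_inv[OF w] by simp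
  next
    case 3
    then have "box_config (inv w) n a b P R s Q f g"
      using B unfolding box_config_def chain_config_def by (elim conjE) (intro conjI; (assumption | linarith))
    then show ?thesis by (rule card_red_tabs_box_config[OF w])
  qed
qed

section \<open>From essential cells to the configuration\<close>

lemma essential_cell:
  assumes w: "w permutes {1..n}" and E: "(i, j) \<in> essential_set n w"
  shows "0 < i" "i < n" "0 < j" "j < n" "j < w i" "i < inv w j" "w (Suc i) \<le> j" "inv w (Suc j) \<le> i"
proof -
  note wi = inv_apply[OF w]
  obtain k where k: "j = w k" "1 \<le> i" "i < k" "k \<le> n" "w k < w i"
    using E by (auto simp: essential_set_def diagram_def)
  show "0 < i" "i < n" "j < w i" using k by auto
  show ij: "i < inv w j" using k wi(2)[of k] by simp
  show "0 < j" using permutes_in[OF w, of k] k by simp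
  have wle: "w i \<le> n" using permutes_le[OF w, of i] k by simp
  then show "j < n" using k by simp
  show "w (Suc i) \<le> j"
  proof (rule ccontr)
    assume *: "\<not> w (Suc i) \<le> j"
    then have "k \<noteq> Suc i" using k by auto
    then have "(i + 1, j) \<in> diagram n w" using * k by (auto simp: diagram_def)
    then show False using E by (simp add: essential_set_def)
  qed
  show "inv w (Suc j) \<le> i"
  proof (rule ccontr)
    assume *: "\<not> inv w (Suc j) \<le> i"
    have "w i \<noteq> Suc j" using * wi(2)[of i] by auto
    then have "Suc j < w i" using k by simp
    moreover have "inv w (Suc j) \<le> n" using permutes_le[OF permutes_inv[OF w], of "Suc j"] \<open>j < n\<close> by simp
    ultimately have "(i, j + 1) \<in> diagram n w"
      using * k wi(1)[of "Suc j"] unfolding diagram_def mem_Collect_eq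
      by (intro exI[of _ i] exI[of _ "inv w (Suc j)"]) simp
    then show False using E by (simp add: essential_set_def)
  qed
qed

text \<open>Choose the leftmost possible position \<open>x\<close> for the smaller entry, then the
  least value \<open>f\<close> inverted with it. A point violating the first condition would give an
  earlier \<open>x\<close>, one violating the second a smaller \<open>f\<close>.\<close>

lemma first_inversion:
  assumes w: "w permutes {1..n::nat}" and "q < inv w f0" "inv w f0 < inv w g0" "s < g0" "g0 < f0" "inv w g0 \<le> n"
  shows "\<exists>f g. q < inv w f \<and> inv w f < inv w g \<and> s < g \<and> g < f \<and> f \<le> n \<and>
    (\<forall>h. inv w f < inv w h \<and> inv w h < inv w g \<and> s < h \<longrightarrow> f < h) \<and>
    (\<forall>h. q < inv w h \<and> inv w h < inv w g \<and> g < h \<longrightarrow> f \<le> h)"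
proof -
  note wi = inv_apply[OF w]
  let ?T = "\<lambda>x. \<exists>f. q < inv w f \<and> inv w f < x \<and> s < w x \<and> w x < f"
  have T0: "?T (inv w g0)" using assms wi(1) by auto
  define x where "x = (LEAST x. ?T x)"
  have Tx: "?T x" unfolding x_def by (rule LeastI[of ?T, OF T0])
  have "x \<le> inv w g0" unfolding x_def by (rule Least_le[of ?T, OF T0])
  then have xn: "x \<le> n" using assms by simp
  let ?U = "\<lambda>f. q < inv w f \<and> inv w f < x \<and> w x < f"
  define f where "f = (LEAST f. ?U f)"
  have "\<exists>f. ?U f" using Tx by blast
  then have U: "?U f" unfolding f_def by (rule LeastI_ex)
  have sx: "s < w x" using Tx by blast
  have ix: "inv w (w x) = x" by (rule wi(2))
  have "f \<le> n"
  proof (rule ccontr)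
    assume "\<not> f \<le> n"
    then show False using permutes_out(1)[OF permutes_inv[OF w], of f] U xn by simp
  qed
  moreover have "f < h" if h: "inv w f < inv w h" "inv w h < x" "s < h" for h
  proof (rule ccontr)
    assume "\<not> f < h"
    moreover have "h \<noteq> f" using h by auto
    ultimately have "?T (inv w h)" using h U wi(1)[of h] by auto
    then show False using not_less_Least[of "inv w h" ?T] h unfolding x_def by blast
  qed
  moreover have "f \<le> h" if "q < inv w h" "inv w h < x" "w x < h" for h
    unfolding f_def by (rule Least_le) (use that in blast)
  ultimately show ?thesis using U sx ix by (intro exI[of _ f] exI[of _ "w x"]) simp
qed

theorem corollary5p15:
  fixes n :: nat and w :: "nat \<Rightarrow> nat"
  assumes "w permutes {1..n}"
    and "k_vexillary 3 n w"
  shows "\<not> (\<exists>i1 j1 i2 j2 i3 j3.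
           (i1, j1) \<in> essential_set n w \<and>
           (i2, j2) \<in> essential_set n w \<and>
           (i3, j3) \<in> essential_set n w \<and>
           i1 < i2 \<and> i2 < i3 \<and> j1 < j2 \<and> j2 < j3)"
proof
  assume "\<exists>i1 j1 i2 j2 i3 j3. (i1, j1) \<in> essential_set n w \<and> (i2, j2) \<in> essential_set n w \<and>
    (i3, j3) \<in> essential_set n w \<and> i1 < i2 \<and> i2 < i3 \<and> j1 < j2 \<and> j2 < j3"
  then obtain i1 j1 i2 j2 i3 j3 where
    E: "(i1, j1) \<in> essential_set n w" "(i2, j2) \<in> essential_set n w" "(i3, j3) \<in> essential_set n w"
    and lt: "i1 < i2" "i2 < i3" "j1 < j2" "j2 < j3" by blast
  note w = assms(1)
  note wi = inv_apply[OF w]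
  note c1 = essential_cell[OF w E(1)] and c2 = essential_cell[OF w E(2)] and c3 = essential_cell[OF w E(3)]
  \<comment> \<open>Adjacent rows are impossible, since \<open>w (Suc i1) \<le> j1\<close> while
    \<open>j1 < j2 < w i2\<close>. The same comparison keeps the other rows and columns
    apart.\<close>
  have a1: "Suc i1 < i2"
  proof -
    have "i2 \<noteq> Suc i1" using c1(7) c2(5) lt by auto
    then show ?thesis using lt by simp
  qed
  have a2: "Suc i2 < i3"
  proof -
    have "i3 \<noteq> Suc i2" using c2(7) c3(5) lt by auto
    then show ?thesis using lt by simp
  qed
  have a3: "Suc j1 < j2"
  proof -
    have "j2 \<noteq> Suc j1" using c1(8) c2(6) lt by auto
    then show ?thesis using lt by simp
  qed
  have a4: "Suc j2 < j3"
  proof -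
    have "j3 \<noteq> Suc j2" using c2(8) c3(6) lt by auto
    then show ?thesis using lt by simp
  qed
  have g3: "inv w j3 \<le> n" using permutes_le[OF permutes_inv[OF w], of j3] c3 by simp
  have q: "inv w (w x) = x" for x by (rule wi(2))
  obtain f g where fg: "Suc i2 < inv w f" "inv w f < inv w g" "Suc j2 < g" "g < f" "f \<le> n"
    "\<forall>h. inv w f < inv w h \<and> inv w h < inv w g \<and> Suc j2 < h \<longrightarrow> f < h"
    "\<forall>h. Suc i2 < inv w h \<and> inv w h < inv w g \<and> g < h \<longrightarrow> f \<le> h"
    using first_inversion[OF w, of "Suc i2" "w i3" j3 "Suc j2"] a2 a4 c3 g3 unfolding q by blast
  have pos: "0 < w (Suc i1)" "0 < w (Suc i2)" "w i2 \<le> n"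
    using permutes_in[OF w, of "Suc i1"] permutes_in[OF w, of "Suc i2"] permutes_in[OF w, of i2] c1 c2 by auto
  \<comment> \<open>The missing south and east neighbours of the first cell put
    \<open>Suc j1\<close> at or above row \<open>i1\<close> and an entry of at most
    \<open>j1\<close> in row \<open>Suc i1\<close>; these are \<open>a\<close> and
    \<open>b\<close>.\<close>
  have "chain_config (inv w) n (Suc j1) (w (Suc i1)) (w i2) j2 (Suc j2) (w (Suc i2)) f g"
    unfolding chain_config_def q using fg pos a1 a3 c1 c2 by (intro conjI) (auto simp: less_Suc_eq_le)
  then have "4 \<le> card (red_tabs n w)" by (rule card_red_tabs_chain_config[OF w])
  also have "\<dots> \<le> EG n w" by (rule red_tabs_EG(2))
  finally show False using assms(2) by (simp add: k_vexillary_def)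
qed

end
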